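(* Let $G$ be a triangulated plane graph and let $\alpha$ and $\beta$ be two internal faces of $G$ having exactly one edge in common. Let $C$ be the set of cycles consisting of the internal faces of $G$, with the cycle $\alpha$ replaced by the cycle $\alpha\,\Delta\,\beta$. Then $C$ cyclically spans the cycle space of $G$.
   Context: A triangulated plane graph is a plane graph all of whose faces are bounded by triangles; internal faces are the bounded faces. A face is identified with its boundary cycle and with the edge set of that cycle; cycles are identified with their edge sets and $\Delta$ denotes symmetric difference. A set of cycles $C$ of $G$ cyclically spans the cycle space of $G$ if for every cycle $\sigma$ of $G$ there are cycles $\alpha_1,\dots,\alpha_m\in C$ such that $\sigma=\alpha_1\Delta\alpha_2\Delta\cdots\Delta\alpha_m$ and, for each $i=2,\dots,m$, $\alpha_1\Delta\cdots\Delta\alpha_i$ is (the edge set of) a cycle of $G$. *)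

theory Defs
  imports "HOL-Analysis.Analysis"
begin

text \<open>
  Plane graphs are finite and simple. The plane is \<^typ>\<open>complex\<close>, vertices are points, and an
  edge is the point set of an arc. An edge contains no vertices except its two endpoints, so the
  endpoints of \<^term>\<open>e\<close> are \<^term>\<open>e \<inter> V\<close> and its interior is \<^term>\<open>e - V\<close>.
\<close>

definition plane_graph :: "complex set \<Rightarrow> complex set set \<Rightarrow> bool" where
  "plane_graph V E \<longleftrightarrow>
     finite V \<and> finite E \<and>
     (\<forall>e\<in>E. \<exists>g. arc g \<and> path_image g = e \<and> e \<inter> V = {pathstart g, pathfinish g}) \<and>
     (\<forall>e\<in>E. \<forall>f\<in>E. e \<noteq> f \<longrightarrow> e \<inter> V \<noteq> f \<inter> V \<and> (e - V) \<inter> f = {})"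

definition faces :: "complex set \<Rightarrow> complex set set \<Rightarrow> complex set set" where
  "faces V E = components (- (V \<union> \<Union>E))"

definition internal_faces :: "complex set \<Rightarrow> complex set set \<Rightarrow> complex set set" where
  "internal_faces V E = {F \<in> faces V E. bounded F}"

text \<open>Cycles are represented by their edge sets; \<^term>\<open>vs\<close> lists the vertices in cyclic order.\<close>

definition is_cycle :: "complex set \<Rightarrow> complex set set \<Rightarrow> complex set set \<Rightarrow> bool" where
  "is_cycle V E D \<longleftrightarrow>
     D \<subseteq> E \<and>
     (\<exists>vs. 3 \<le> length vs \<and> distinct vs \<and> set vs \<subseteq> V \<and>
       (\<lambda>e. e \<inter> V) ` D = {{vs ! i, vs ! (Suc i mod length vs)} | i. i < length vs})"

definition boundary_edges :: "complex set set \<Rightarrow> complex set \<Rightarrow> complex set set" where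
  "boundary_edges E F = {e \<in> E. e \<subseteq> frontier F}"

definition triangulated_plane_graph :: "complex set \<Rightarrow> complex set set \<Rightarrow> bool" where
  "triangulated_plane_graph V E \<longleftrightarrow>
     plane_graph V E \<and>
     (\<forall>F\<in>faces V E.
        is_cycle V E (boundary_edges E F) \<and> card (boundary_edges E F) = 3 \<and>
        frontier F = \<Union>(boundary_edges E F))"

definition internal_face_cycles :: "complex set \<Rightarrow> complex set set \<Rightarrow> complex set set set" where
  "internal_face_cycles V E = boundary_edges E ` internal_faces V E"

definition cyclically_spans ::
    "complex set \<Rightarrow> complex set set \<Rightarrow> complex set set set \<Rightarrow> bool" where
  "cyclically_spans V E C \<longleftrightarrow>
     (\<forall>c\<in>C. is_cycle V E c) \<and>
     (\<forall>\<sigma>. is_cycle V E \<sigma> \<longrightarrow>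
        (\<exists>as. as \<noteq> [] \<and> set as \<subseteq> C \<and> \<sigma> = foldl sym_diff {} as \<and>
           (\<forall>i\<in>{2..length as}. is_cycle V E (foldl sym_diff {} (take i as)))))"

end

theory Submission
  imports Defs "HOL-Complex_Analysis.Winding_Numbers"
begin

text \<open>
  Write \<open>bdry S\<close> for the set of edges that separate a face in \<open>S\<close> from a face outside \<open>S\<close>. By the Jordan
  curve theorem every edge lies on exactly two faces, every cycle is \<open>bdry S\<close> for a set \<open>S\<close> of faces,
  and \<open>bdry S\<close> determines \<open>S\<close> up to complement. Since \<open>bdry S\<close> has even degree at every vertex, a set
  of faces whose boundary lies inside a cycle \<open>bdry S\<close> is empty, everything, \<open>S\<close> or the complement of \<open>S\<close>.

  The key step: if \<open>bdry S\<close> is a cycle and \<open>F0\<close> is a face in \<open>S\<close>, the faces of \<open>S\<close> other than \<open>F0\<close> can be removed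
  one at a time so that the boundary remains a cycle, until only \<open>F0\<close> is left. The outer face is treated
  like any other, so this shrinks a cycle to an inner face as well as expanding it to the outer triangle.

  Let \<open>\<sigma>\<close> be a cycle. If \<open>\<alpha>\<close> is outside \<open>\<sigma>\<close>, shrink \<open>\<sigma>\<close> to any face inside it and read the sequence backwards.
  If \<open>\<alpha>\<close> is inside \<open>\<sigma>\<close>, expand the cycle \<open>\<alpha> \<Delta> \<beta>\<close> to the outer triangle and then follow the expansion of
  \<open>\<sigma>\<close> to the outer triangle backwards; neither expansion uses \<open>\<alpha>\<close>.
\<close>

section \<open>Cyclic vertex lists\<close>

fun walk_edges :: "'a list \<Rightarrow> 'a set set" where
  "walk_edges (x # y # zs) = insert {x, y} (walk_edges (y # zs))"
| "walk_edges _ = {}"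

text \<open>The comprehension has the form used in \<open>is_cycle\<close>, so unfolding alone gives
  \<open>is_cycle_iff\<close>; cutting and joining cycles goes through
  \<open>walk_edges\<close>.\<close>

definition cyc_edges :: "'a list \<Rightarrow> 'a set set" where
  "cyc_edges vs = {{vs ! i, vs ! (Suc i mod length vs)} | i. i < length vs}"

lemma walk_edges_conv_nth: "walk_edges vs = {{vs ! i, vs ! Suc i} | i. Suc i < length vs}"
proof (induction vs rule: walk_edges.induct)
  case (1 x y zs)
  have "Suc i < length (x # y # zs) \<longleftrightarrow> i = 0 \<or> (\<exists>j. i = Suc j \<and> Suc j < length (y # zs))" for i
    by (cases i) auto
  then have "{{(x # y # zs) ! i, (x # y # zs) ! Suc i} | i. Suc i < length (x # y # zs)}
      = insert {x, y} {{(y # zs) ! i, (y # zs) ! Suc i} | i. Suc i < length (y # zs)}"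
    by (auto simp only: nth_Cons_0 nth_Cons_Suc) (metis nth_Cons_0 nth_Cons_Suc)+
  then show ?case using 1 by simp
qed auto

lemma cyc_edges_conv_walk:
  assumes "vs \<noteq> []"
  shows "cyc_edges vs = walk_edges (vs @ [hd vs])"
proof -
  have "vs ! (Suc i mod length vs) = (vs @ [hd vs]) ! Suc i" if "i < length vs" for i
  proof (cases "Suc i = length vs")
    case True
    then show ?thesis using assms by (simp add: nth_append hd_conv_nth)
  next
    case False
    then show ?thesis using that by (simp add: nth_append)
  qed
  then show ?thesis
    unfolding cyc_edges_def walk_edges_conv_nth
    by (intro Collect_cong ex_cong1) (auto simp: nth_append)
qed

lemma walk_edges_append: "walk_edges (xs @ y # ys) = walk_edges (xs @ [y]) \<union> walk_edges (y # ys)"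
  by (induction xs rule: walk_edges.induct) auto

lemma cyc_edges_conv_last:
  assumes "vs \<noteq> []"
  shows "cyc_edges vs = insert {last vs, hd vs} (walk_edges vs)"
proof -
  have "walk_edges ((butlast vs @ [last vs]) @ [hd vs]) = walk_edges (butlast vs @ [last vs]) \<union> {{last vs, hd vs}}"
    using walk_edges_append[of "butlast vs" "last vs" "[hd vs]"] by simp
  then show ?thesis using cyc_edges_conv_walk[OF assms] assms by simp
qed

lemma cyc_edges_append_commute: "cyc_edges (xs @ ys) = cyc_edges (ys @ xs)"
proof (cases "xs = [] \<or> ys = []")
  case False
  then obtain a as b bs where "xs = a # as" "ys = b # bs"
    by (metis neq_Nil_conv)
  then show ?thesis
    using walk_edges_append[of "a # as" b "bs @ [a]"] walk_edges_append[of "b # bs" a "as @ [b]"]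
    by (simp add: cyc_edges_conv_walk Un_commute)
qed auto

lemma walk_edges_subset: "e \<in> walk_edges vs \<Longrightarrow> e \<subseteq> set vs"
  by (induction vs rule: walk_edges.induct) auto

lemma Union_cyc_edges: "\<Union>(cyc_edges vs) = set vs"
proof
  show "\<Union>(cyc_edges vs) \<subseteq> set vs"
    unfolding cyc_edges_def by (auto intro!: nth_mem mod_less_divisor)
  show "set vs \<subseteq> \<Union>(cyc_edges vs)"
  proof
    fix v assume "v \<in> set vs"
    then obtain i where "i < length vs" "v = vs ! i" by (auto simp: in_set_conv_nth)
    then have "{vs ! i, vs ! (Suc i mod length vs)} \<in> cyc_edges vs" "v \<in> {vs ! i, vs ! (Suc i mod length vs)}"
      by (auto simp: cyc_edges_def)
    then show "v \<in> \<Union>(cyc_edges vs)" by blast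
  qed
qed

text \<open>The closing pair joins the last and the first index, which are neighbours in the list
  only when it has two entries; hence the bound 3.\<close>

lemma closing_edge_notin_walk_edges:
  assumes "distinct vs" "3 \<le> length vs"
  shows "{last vs, hd vs} \<notin> walk_edges vs"
proof
  assume "{last vs, hd vs} \<in> walk_edges vs"
  then obtain i where i: "{last vs, hd vs} = {vs ! i, vs ! Suc i}" "Suc i < length vs"
    by (auto simp: walk_edges_conv_nth)
  moreover have "last vs = vs ! (length vs - 1)" "hd vs = vs ! 0"
    using assms by (auto simp: last_conv_nth hd_conv_nth simp flip: length_greater_0_conv)
  ultimately have "(length vs - 1 = i \<and> 0 = Suc i) \<or> (length vs - 1 = Suc i \<and> 0 = i)"
    using assms i(2) nth_eq_iff_index_eq[OF assms(1)] unfolding doubleton_eq_iff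
    by (metis Suc_lessD diff_less less_numeral_extra(1) not_less_zero gr0I)
  then show False using assms(2) by auto
qed

text \<open>Rotating by \<open>Suc i\<close> puts the \<open>i\<close>-th entry last and its
  successor first, so any prescribed edge can be taken as the closing one.\<close>

lemma cyc_edges_rotate_to_edge:
  assumes "p \<in> cyc_edges vs"
  obtains us where "cyc_edges us = cyc_edges vs" "set us = set vs" "length us = length vs"
    "distinct us = distinct vs" "p = {last us, hd us}" "us \<noteq> []"
proof -
  obtain i where i: "i < length vs" "p = {vs ! i, vs ! (Suc i mod length vs)}"
    using assms by (auto simp: cyc_edges_def)
  define us where "us = rotate (Suc i) vs"
  have ne: "vs \<noteq> []" "us \<noteq> []" using i by (auto simp: us_def)
  have "last us = us ! (length vs - 1)"
    using ne by (simp add: last_conv_nth us_def)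
  also have "\<dots> = vs ! ((Suc i + (length vs - 1)) mod length vs)"
    unfolding us_def using ne by (intro nth_rotate) simp
  also have "Suc i + (length vs - 1) = i + length vs" using ne by (cases vs) auto
  finally have last: "last us = vs ! i" using i by simp
  have "cyc_edges us = cyc_edges (take (Suc i mod length vs) vs @ drop (Suc i mod length vs) vs)"
    unfolding us_def rotate_drop_take by (rule cyc_edges_append_commute)
  then have "cyc_edges us = cyc_edges vs" by (simp only: append_take_drop_id)
  then show ?thesis
    using that[of us] i last hd_rotate_conv_nth[OF ne(1), of "Suc i"] ne by (simp add: us_def)
qed

text \<open>A vertex of the cycle lies on exactly two of its edges, so even degree forces both or
  neither into \<open>X\<close>; membership then spreads from \<open>f 0\<close> along the
  list.\<close>

lemma cyc_edges_even_subset: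
  assumes "distinct vs" "3 \<le> length vs" "X \<subseteq> cyc_edges vs"
    and even: "\<And>v. even (card {e \<in> X. v \<in> e})"
  shows "X = {} \<or> X = cyc_edges vs"
proof -
  define n where "n = length vs"
  define f where "f i = {vs ! i, vs ! (Suc i mod n)}" for i
  have n: "3 \<le> n" using assms n_def by simp
  have ce: "cyc_edges vs = f ` {..<n}"
    by (auto simp: cyc_edges_def f_def n_def)
  have nth: "vs ! i = vs ! j \<longleftrightarrow> i = j" if "i < n" "j < n" for i j
    using that assms(1) by (simp add: n_def nth_eq_iff_index_eq)
  have step: "f i \<in> X \<longleftrightarrow> f (Suc i) \<in> X" if i: "Suc i < n" for i
  proof -
    have neq: "f i \<noteq> f (Suc i)"
      using i n nth by (auto simp: f_def doubleton_eq_iff mod_Suc)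
    have only: "e = f i \<or> e = f (Suc i)" if e: "e \<in> cyc_edges vs" "vs ! Suc i \<in> e" for e
    proof -
      obtain j where j: "j < n" "e = f j" using e(1) ce by auto
      then have "Suc i = j \<or> Suc i = Suc j mod n"
        using e(2) i n nth by (auto simp: f_def)
      then show ?thesis using j i by (auto simp: mod_Suc split: if_splits)
    qed
    have "vs ! Suc i \<in> f i" "vs ! Suc i \<in> f (Suc i)"
      using i by (auto simp: f_def)
    then have eq: "{e \<in> X. vs ! Suc i \<in> e} = {e \<in> {f i, f (Suc i)}. e \<in> X}"
      using only assms(3) by blast
    have "even (card {e \<in> {f i, f (Suc i)}. e \<in> X})"
      using even[of "vs ! Suc i"] by (simp only: eq)
    moreover have "{e \<in> {f i, f (Suc i)}. e \<in> X} = (if f i \<in> X then {f i} else {}) \<union> (if f (Suc i) \<in> X then {f (Suc i)} else {})"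
      by auto
    ultimately show ?thesis using neq by (auto split: if_splits)
  qed
  have "f i \<in> X \<longleftrightarrow> f 0 \<in> X" if "i < n" for i
    using that by (induction i) (auto simp: step)
  then show ?thesis using assms(3) ce by (cases "f 0 \<in> X") auto
qed

text \<open>The chord cuts the cyclic list into two walks between \<open>a\<close> and
  \<open>b\<close>, and each is closed up by the chord. As \<open>{a, b}\<close> is not an edge,
  each walk has an inner vertex, which gives length 3.\<close>

lemma cyc_edges_chord:
  assumes "distinct vs" "3 \<le> length vs" "a \<in> set vs" "b \<in> set vs" "a \<noteq> b" "{a, b} \<notin> cyc_edges vs"
  obtains us ws where "distinct us" "distinct ws" "3 \<le> length us" "3 \<le> length ws"
    "set us \<subseteq> set vs" "set ws \<subseteq> set vs" "cyc_edges us \<union> cyc_edges ws = insert {a, b} (cyc_edges vs)"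
    "cyc_edges us \<inter> cyc_edges ws = {{a, b}}"
proof -
  obtain xs ys where vs: "vs = xs @ a # ys" using assms(3) by (meson split_list)
  define zs where "zs = ys @ xs"
  have ce: "cyc_edges (a # zs) = cyc_edges vs"
    using cyc_edges_append_commute[of "a # ys" xs] by (simp add: vs zs_def)
  have d: "distinct (a # zs)" "set (a # zs) = set vs"
    using assms(1) by (auto simp: vs zs_def)
  obtain ps qs where zs: "zs = ps @ b # qs"
    using assms(4,5) d by (metis set_ConsD split_list)
  have ps: "ps \<noteq> []" and qs: "qs \<noteq> []"
    using assms(6) ce by (auto simp: zs cyc_edges_conv_last insert_commute)
  have 1: "cyc_edges (a # ps @ [b]) = insert {a, b} (walk_edges (a # ps @ [b]))"
    by (simp add: cyc_edges_conv_last insert_commute)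
  have 2: "cyc_edges (b # qs @ [a]) = insert {a, b} (walk_edges (b # qs @ [a]))"
    by (simp add: cyc_edges_conv_last)
  have 3: "cyc_edges vs = walk_edges (a # ps @ [b]) \<union> walk_edges (b # qs @ [a])"
    using walk_edges_append[of "a # ps" b "qs @ [a]"] ce zs by (simp add: cyc_edges_conv_walk)
  \<comment> \<open>The two walks share only the vertices \<open>a\<close> and \<open>b\<close>, and
    a walk edge has two distinct ends.\<close>
  have disj: "e = {a, b}" if e: "e \<in> walk_edges (a # ps @ [b])" "e \<in> walk_edges (b # qs @ [a])" for e
  proof -
    have "e \<subseteq> {a, b}" using walk_edges_subset[OF e(1)] walk_edges_subset[OF e(2)] d by (auto simp: zs)
    moreover obtain i where i: "Suc i < length (a # ps @ [b])"
      "e = {(a # ps @ [b]) ! i, (a # ps @ [b]) ! Suc i}"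
      using e(1) unfolding walk_edges_conv_nth by blast
    moreover have "distinct (a # ps @ [b])" using d by (auto simp: zs)
    then have "(a # ps @ [b]) ! i \<noteq> (a # ps @ [b]) ! Suc i"
      using i(1) by (metis Suc_lessD n_not_Suc_n nth_eq_iff_index_eq)
    ultimately show ?thesis by (smt (verit) doubleton_eq_iff insert_subset insertE singletonD)
  qed
  show ?thesis
  proof (rule that[of "a # ps @ [b]" "b # qs @ [a]"])
    show "3 \<le> length (a # ps @ [b])" "3 \<le> length (b # qs @ [a])"
      using ps qs by (cases ps; cases qs; simp)+
    show "cyc_edges (a # ps @ [b]) \<inter> cyc_edges (b # qs @ [a]) = {{a, b}}"
      using disj by (auto simp: 1 2)
  qed (use d zs 1 2 3 in auto)
qed

text \<open>Two different positions with the same pair would each be the cyclic successor of the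
  other, which needs a list of length 2.\<close>

lemma card_cyc_edges:
  assumes "distinct vs" "3 \<le> length vs"
  shows "card (cyc_edges vs) = length vs"
proof -
  define n where "n = length vs"
  have nth: "vs ! i = vs ! j \<longleftrightarrow> i = j" if "i < n" "j < n" for i j
    using that assms(1) by (simp add: n_def nth_eq_iff_index_eq)
  have "cyc_edges vs = (\<lambda>i. {vs ! i, vs ! (Suc i mod n)}) ` {..<n}"
    by (auto simp: cyc_edges_def n_def)
  moreover have "inj_on (\<lambda>i. {vs ! i, vs ! (Suc i mod n)}) {..<n}"
  proof (rule inj_onI)
    fix i j assume ij: "i \<in> {..<n}" "j \<in> {..<n}" "{vs ! i, vs ! (Suc i mod n)} = {vs ! j, vs ! (Suc j mod n)}"
    then have "Suc i mod n < n" "Suc j mod n < n" by auto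
    then have "i = j \<or> (i = Suc j mod n \<and> Suc i mod n = j)"
      using ij nth unfolding doubleton_eq_iff by (metis lessThan_iff)
    then show "i = j" using assms(2) ij by (auto simp: mod_Suc n_def split: if_splits)
  qed
  ultimately show ?thesis by (simp add: card_image n_def)
qed

section \<open>Cycles of plane graphs\<close>

lemma is_cycle_iff:
  "is_cycle V E D \<longleftrightarrow> D \<subseteq> E \<and>
     (\<exists>vs. 3 \<le> length vs \<and> distinct vs \<and> set vs \<subseteq> V \<and> (\<lambda>e. e \<inter> V) ` D = cyc_edges vs)"
  unfolding is_cycle_def cyc_edges_def ..

text \<open>Simplicity of the graph in the form that carries statements about endpoint pairs over to
  edges as point sets.\<close>

lemma plane_graph_inj_on_ends: "plane_graph V E \<Longrightarrow> inj_on (\<lambda>e. e \<inter> V) E"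
  unfolding plane_graph_def inj_on_def by blast

lemma plane_graph_edge_ends:
  assumes "plane_graph V E" "e \<in> E"
  obtains a b where "a \<noteq> b" "e \<inter> V = {a, b}"
  using assms unfolding plane_graph_def by (metis arc_distinct_ends)

lemma plane_graph_edge_eqI:
  assumes "plane_graph V E" "e \<in> E" "f \<in> E" "p \<in> e" "p \<in> f" "p \<notin> V"
  shows "e = f"
  using assms unfolding plane_graph_def by blast

lemma is_cycle_subset: "is_cycle V E D \<Longrightarrow> D \<subseteq> E"
  by (simp add: is_cycle_def)

lemma is_cycle_nonempty: "is_cycle V E D \<Longrightarrow> D \<noteq> {}"
  unfolding is_cycle_iff cyc_edges_def by fastforce

lemma is_cycle_even_subset:
  assumes pg: "plane_graph V E" and "is_cycle V E D" "X \<subseteq> D"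
    and even: "\<And>v. v \<in> V \<Longrightarrow> even (card {e \<in> X. v \<in> e})"
  shows "X = {} \<or> X = D"
proof -
  obtain vs where vs: "3 \<le> length vs" "distinct vs" "set vs \<subseteq> V" "(\<lambda>e. e \<inter> V) ` D = cyc_edges vs"
    and D: "D \<subseteq> E"
    using assms(2) by (auto simp: is_cycle_iff)
  have inj: "inj_on (\<lambda>e. e \<inter> V) D"
    using plane_graph_inj_on_ends[OF pg] D by (rule inj_on_subset)
  have "even (card {e \<in> (\<lambda>e. e \<inter> V) ` X. v \<in> e})" for v
  proof (cases "v \<in> V")
    case True
    have "{e \<in> (\<lambda>e. e \<inter> V) ` X. v \<in> e} = (\<lambda>e. e \<inter> V) ` {e \<in> X. v \<in> e}"
      using True by auto
    moreover have "inj_on (\<lambda>e. e \<inter> V) {e \<in> X. v \<in> e}"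
      using inj assms(3) by (auto intro: inj_on_subset)
    ultimately show ?thesis using even[OF True] by (simp add: card_image)
  next
    case False
    then have "{e \<in> (\<lambda>e. e \<inter> V) ` X. v \<in> e} = {}" by auto
    then show ?thesis by (simp only: card.empty even_zero)
  qed
  then have "(\<lambda>e. e \<inter> V) ` X = {} \<or> (\<lambda>e. e \<inter> V) ` X = (\<lambda>e. e \<inter> V) ` D"
    using cyc_edges_even_subset[OF vs(2,1)] assms(3) vs(4) by (metis image_mono)
  then show ?thesis using inj_on_image_eq_iff[OF inj assms(3) order_refl] by blast
qed

lemma is_cycle_chord:
  assumes pg: "plane_graph V E" and "is_cycle V E D" and e: "e \<in> E" "e \<notin> D" and "e \<inter> V \<subseteq> \<Union>D"
  obtains D1 D2 where "is_cycle V E D1" "is_cycle V E D2" "D1 \<union> D2 = insert e D" "D1 \<inter> D2 = {e}"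
proof -
  obtain vs where vs: "3 \<le> length vs" "distinct vs" "set vs \<subseteq> V" "(\<lambda>e. e \<inter> V) ` D = cyc_edges vs"
    and D: "D \<subseteq> E"
    using assms(2) by (auto simp: is_cycle_iff)
  have inj: "inj_on (\<lambda>e. e \<inter> V) (insert e D)"
    using plane_graph_inj_on_ends[OF pg] by (rule inj_on_subset) (use D e in auto)
  obtain a b where ab: "a \<noteq> b" "e \<inter> V = {a, b}"
    using plane_graph_edge_ends[OF pg e(1)] .
  have "\<Union>D \<inter> V = set vs"
    unfolding Union_cyc_edges[symmetric] vs(4)[symmetric] by blast
  then have "a \<in> set vs" "b \<in> set vs" using ab assms(5) by blast+
  moreover have "{a, b} \<notin> cyc_edges vs"
  proof
    assume "{a, b} \<in> cyc_edges vs"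
    then obtain f where "f \<in> D" "e \<inter> V = f \<inter> V" using vs(4) ab(2) by (metis image_iff)
    then show False using inj e(2) unfolding inj_on_def by blast
  qed
  ultimately obtain us ws where uw: "distinct us" "distinct ws" "3 \<le> length us" "3 \<le> length ws"
    "set us \<subseteq> set vs" "set ws \<subseteq> set vs" "cyc_edges us \<union> cyc_edges ws = insert {a, b} (cyc_edges vs)"
    "cyc_edges us \<inter> cyc_edges ws = {{a, b}}"
    using cyc_edges_chord[OF vs(2,1)] ab(1) by metis
  \<comment> \<open>The two lists are pulled back to edges; injectivity of the endpoint map makes
    the pull-backs meet only in \<open>e\<close>.\<close>
  define D1 where "D1 = {f \<in> insert e D. f \<inter> V \<in> cyc_edges us}"
  define D2 where "D2 = {f \<in> insert e D. f \<inter> V \<in> cyc_edges ws}"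
  have im: "(\<lambda>e. e \<inter> V) ` insert e D = insert {a, b} (cyc_edges vs)"
    using vs(4) ab by simp
  have preim: "(\<lambda>e. e \<inter> V) ` {f \<in> insert e D. f \<inter> V \<in> B} = B" if "B \<subseteq> (\<lambda>e. e \<inter> V) ` insert e D" for B
    using that by blast
  have "(\<lambda>e. e \<inter> V) ` D1 = cyc_edges us" "(\<lambda>e. e \<inter> V) ` D2 = cyc_edges ws"
    unfolding D1_def D2_def using uw(7) unfolding im[symmetric]
    by (metis preim sup_ge1, metis preim sup_ge2)
  moreover have "D1 \<subseteq> E" "D2 \<subseteq> E" using D e by (auto simp: D1_def D2_def)
  ultimately have "is_cycle V E D1" "is_cycle V E D2"
    using uw(1-6) vs(3) unfolding is_cycle_iff by (metis order_trans)+
  moreover have "D1 \<union> D2 = insert e D"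
  proof -
    have "f \<inter> V \<in> cyc_edges us \<union> cyc_edges ws" if "f \<in> insert e D" for f
      unfolding uw(7) im[symmetric] using that by (rule imageI)
    then show ?thesis unfolding D1_def D2_def by blast
  qed
  moreover have "D1 \<inter> D2 = {e}"
  proof -
    have "f = e" if "f \<in> D1" "f \<in> D2" for f
    proof -
      have f: "f \<in> insert e D" "f \<inter> V \<in> cyc_edges us \<inter> cyc_edges ws"
        using that unfolding D1_def D2_def by simp_all
      then have "f \<inter> V = e \<inter> V" unfolding uw(8) ab(2) by simp
      then show ?thesis using inj_onD[OF inj _ f(1)] by simp
    qed
    moreover have "e \<inter> V \<in> cyc_edges us \<inter> cyc_edges ws" unfolding uw(8) ab(2) by simp
    then have "e \<in> D1 \<inter> D2" unfolding D1_def D2_def by simp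
    ultimately show ?thesis by blast
  qed
  ultimately show ?thesis using that by blast
qed

text \<open>With \<open>p\<close> rotated to the closing position, appending the new vertex
  \<open>w\<close> replaces \<open>p\<close> by the path through \<open>w\<close> and keeps the list
  distinct.\<close>

lemma is_cycle_ear:
  assumes pg: "plane_graph V E" and "is_cycle V E D" and p: "p \<in> D" "p \<inter> V = {x, y}"
    and q: "q \<in> E" "q \<inter> V = {x, w}" and r: "r \<in> E" "r \<inter> V = {y, w}"
    and w: "w \<in> V" "w \<notin> \<Union>D"
  shows "is_cycle V E (D - {p} \<union> {q, r})"
proof -
  obtain vs where vs: "3 \<le> length vs" "distinct vs" "set vs \<subseteq> V" "(\<lambda>e. e \<inter> V) ` D = cyc_edges vs"
    and D: "D \<subseteq> E"
    using assms(2) by (auto simp: is_cycle_iff)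
  have inj: "inj_on (\<lambda>e. e \<inter> V) D"
    using plane_graph_inj_on_ends[OF pg] D by (rule inj_on_subset)
  have "{x, y} \<in> cyc_edges vs" using p vs(4) by blast
  then obtain us where us: "cyc_edges us = cyc_edges vs" "set us = set vs" "length us = length vs"
    "distinct us = distinct vs" "{x, y} = {last us, hd us}" "us \<noteq> []"
    by (rule cyc_edges_rotate_to_edge)
  have "\<Union>D \<inter> V = set vs"
    unfolding Union_cyc_edges[symmetric] vs(4)[symmetric] by blast
  then have "w \<notin> set us" using w us by auto
  have walk: "walk_edges us = cyc_edges vs - {{x, y}}"
    using us vs cyc_edges_conv_last[of us] closing_edge_notin_walk_edges[of us] by auto
  have "cyc_edges (us @ [w]) = walk_edges us \<union> {{last us, w}, {w, hd us}}"
  proof -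
    have "walk_edges ((butlast us @ [last us]) @ [w]) = walk_edges (butlast us @ [last us]) \<union> {{last us, w}}"
      using walk_edges_append[of "butlast us" "last us" "[w]"] by simp
    then have "walk_edges (us @ [w]) = walk_edges us \<union> {{last us, w}}"
      using us(6) by simp
    then show ?thesis using us(6) by (simp add: cyc_edges_conv_last insert_commute)
  qed
  also have "\<dots> = walk_edges us \<union> {{x, w}, {y, w}}"
    using us(5) unfolding doubleton_eq_iff by (elim disjE conjE) (simp_all add: insert_commute)
  also have "\<dots> = (\<lambda>e. e \<inter> V) ` (D - {p} \<union> {q, r})"
    using inj_on_image_set_diff[OF inj, of D "{p}"] p q r vs(4) walk by (simp add: image_Un)
  finally have "(\<lambda>e. e \<inter> V) ` (D - {p} \<union> {q, r}) = cyc_edges (us @ [w])" ..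
  moreover have "3 \<le> length (us @ [w])" "distinct (us @ [w])" "set (us @ [w]) \<subseteq> V"
    using us vs w \<open>w \<notin> set us\<close> by auto
  ultimately show ?thesis
    unfolding is_cycle_iff using D q r by blast
qed

text \<open>Names the vertex \<open>w\<close> opposite \<open>p\<close> and the other two edges.
  With \<open>p\<close> in the closing position the list is \<open>[a, b, c]\<close>, and
  \<open>w\<close> is its middle entry.\<close>

lemma is_cycle_triangle:
  assumes "plane_graph V E" "is_cycle V E D" "card D = 3" "p \<in> D" "p \<inter> V = {x, y}"
  obtains w q r where "D = {p, q, r}" "q \<inter> V = {x, w}" "r \<inter> V = {y, w}" "w \<in> V" "w \<noteq> x" "w \<noteq> y" "x \<noteq> y"
proof -
  obtain vs where vs: "3 \<le> length vs" "distinct vs" "set vs \<subseteq> V" "(\<lambda>e. e \<inter> V) ` D = cyc_edges vs"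
    and D: "D \<subseteq> E"
    using assms(2) by (auto simp: is_cycle_iff)
  have inj: "inj_on (\<lambda>e. e \<inter> V) D"
    using plane_graph_inj_on_ends[OF assms(1)] D by (rule inj_on_subset)
  have "{x, y} \<in> cyc_edges vs" using assms(4,5) vs(4) by blast
  then obtain us where us: "cyc_edges us = cyc_edges vs" "set us = set vs" "length us = length vs"
    "distinct us = distinct vs" "{x, y} = {last us, hd us}" "us \<noteq> []"
    by (rule cyc_edges_rotate_to_edge)
  have "length us = 3"
    using card_cyc_edges[OF vs(2,1)] card_image[OF inj] vs(4) assms(3) us(3) by simp
  then obtain a b c where abc: "us = [a, b, c]"
    by (auto simp: length_Suc_conv numeral_3_eq_3)
  have ce: "cyc_edges us = {{a, b}, {b, c}, {c, a}}"
    by (simp add: abc cyc_edges_conv_walk)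
  have dist: "a \<noteq> b" "b \<noteq> c" "a \<noteq> c" using us(4) vs(2) abc by auto
  have xy: "x = a \<and> y = c \<or> x = c \<and> y = a"
    using us(5) abc by (auto simp: doubleton_eq_iff)
  then have ce': "(\<lambda>e. e \<inter> V) ` D = {{x, y}, {x, b}, {y, b}}"
    using ce us(1) vs(4) by (auto simp: insert_commute)
  obtain q where q: "q \<in> D" "q \<inter> V = {x, b}" using ce' by (metis image_iff insertI1 insertI2)
  obtain r where r: "r \<in> D" "r \<inter> V = {y, b}" using ce' by (metis image_iff insertI1 insertI2)
  have "f \<in> {p, q, r}" if "f \<in> D" for f
  proof -
    have "f \<inter> V \<in> {{x, y}, {x, b}, {y, b}}" unfolding ce'[symmetric] using that by (rule imageI)
    then have "f \<inter> V = p \<inter> V \<or> f \<inter> V = q \<inter> V \<or> f \<inter> V = r \<inter> V" unfolding assms(5) q(2) r(2) by simp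
    then show ?thesis using inj_onD[OF inj _ that] assms(4) q(1) r(1) by (elim disjE) auto
  qed
  then have "D = {p, q, r}" using assms(4) q r by blast
  moreover have "b \<in> V" using vs(3) us(2) abc by auto
  ultimately show ?thesis using that q r dist xy by metis
qed

section \<open>Walks and cycles as arcs and Jordan curves\<close>

lemma plane_graph_Union_Int:
  assumes "plane_graph V E" "A \<subseteq> E" "B \<subseteq> E" "A \<inter> B = {}"
  shows "\<Union>A \<inter> \<Union>B \<subseteq> V"
  using assms plane_graph_edge_eqI by blast

lemma plane_graph_edge_arc:
  assumes "plane_graph V E" "e \<in> E" "e \<inter> V = {a, b}"
  obtains g where "arc g" "path_image g = e" "pathstart g = a" "pathfinish g = b"
proof -
  obtain g where g: "arc g" "path_image g = e" "{a, b} = {pathstart g, pathfinish g}"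
    using assms unfolding plane_graph_def by metis
  then consider "pathstart g = a" "pathfinish g = b" | "pathstart g = b" "pathfinish g = a"
    by (auto simp: doubleton_eq_iff)
  then show ?thesis
  proof cases
    case 1
    then show ?thesis using g that by blast
  next
    case 2
    then show ?thesis using g that[of "reversepath g"] by (simp add: arc_reversepath)
  qed
qed

text \<open>The edge arcs are joined one after another. Distinct edges meet only in vertices and the
  first vertex does not recur, so the first edge meets the rest only in \<open>y\<close>.\<close>

lemma plane_graph_walk_arc:
  assumes pg: "plane_graph V E"
  shows "2 \<le> length vs \<Longrightarrow> distinct vs \<Longrightarrow> D \<subseteq> E \<Longrightarrow> (\<lambda>e. e \<inter> V) ` D = walk_edges vs \<Longrightarrow>
    \<exists>g. arc g \<and> path_image g = \<Union>D \<and> pathstart g = hd vs \<and> pathfinish g = last vs"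
proof (induction vs arbitrary: D rule: walk_edges.induct)
  case (1 x y zs)
  have inj: "inj_on (\<lambda>e. e \<inter> V) D"
    using plane_graph_inj_on_ends[OF pg] 1(4) by (rule inj_on_subset)
  obtain e where e: "e \<in> D" "e \<inter> V = {x, y}" using 1(5) by (metis image_iff insertI1 walk_edges.simps(1))
  obtain g where g: "arc g" "path_image g = e" "pathstart g = x" "pathfinish g = y"
    using plane_graph_edge_arc[OF pg _ e(2)] e(1) 1(4) by blast
  have notin: "{x, y} \<notin> walk_edges (y # zs)"
    using 1(3) walk_edges_subset[of "{x, y}" "y # zs"] by auto
  have im: "(\<lambda>e. e \<inter> V) ` (D - {e}) = walk_edges (y # zs)"
    using inj_on_image_set_diff[OF inj, of D "{e}"] e 1(5) notin by auto
  show ?case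
  proof (cases "zs = []")
    case True
    then have "D = {e}" using im e by auto
    then show ?thesis using g True by auto
  next
    case False
    then obtain h where h: "arc h" "path_image h = \<Union>(D - {e})" "pathstart h = y" "pathfinish h = last (y # zs)"
      using 1(1)[of "D - {e}"] 1(3,4) im by (cases zs) auto
    have "e \<inter> \<Union>(D - {e}) \<subseteq> V"
      using plane_graph_Union_Int[OF pg, of "{e}" "D - {e}"] e 1(4) by auto
    have "\<Union>(D - {e}) \<inter> V \<subseteq> set (y # zs)"
    proof -
      have "\<Union>(D - {e}) \<inter> V = \<Union>((\<lambda>e. e \<inter> V) ` (D - {e}))" by blast
      also have "\<dots> \<subseteq> set (y # zs)" unfolding im using walk_edges_subset by blast
      finally show ?thesis .
    qed
    have "x \<notin> set (y # zs)" using 1(3) by simp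
    have "p = y" if "p \<in> e" "p \<in> \<Union>(D - {e})" for p
    proof -
      have "p \<in> V" "p \<in> e" using that \<open>e \<inter> \<Union>(D - {e}) \<subseteq> V\<close> by (meson IntI subsetD)+
      moreover from this have "p \<in> set (y # zs)"
        using that(2) \<open>\<Union>(D - {e}) \<inter> V \<subseteq> set (y # zs)\<close> by (meson IntI subsetD)
      ultimately show ?thesis using e(2) \<open>x \<notin> set (y # zs)\<close> by (metis IntI insertE singletonD)
    qed
    then have "path_image g \<inter> path_image h \<subseteq> {pathstart h}"
      unfolding g(2) h(2) h(3) by (metis (no_types, lifting) IntD1 IntD2 singletonI subsetI)
    then have "arc (g +++ h)" using g h by (intro arc_join) simp_all
    moreover have "path_image (g +++ h) = \<Union>D"
    proof -
      have "path_image (g +++ h) = e \<union> \<Union>(D - {e})" using g h by (simp add: path_image_join)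
      then show ?thesis using e(1) by blast
    qed
    ultimately show ?thesis
      using g(3) h(4) by (intro exI[of _ "g +++ h"]) simp
  qed
qed auto

text \<open>The cycle is opened at its closing edge; the remaining walk is an arc that meets this
  edge only in the common endpoints.\<close>

lemma is_cycle_simple_path:
  assumes pg: "plane_graph V E" and "is_cycle V E D"
  obtains g where "simple_path g" "pathfinish g = pathstart g" "path_image g = \<Union>D"
proof -
  obtain vs where vs: "3 \<le> length vs" "distinct vs" "set vs \<subseteq> V" "(\<lambda>e. e \<inter> V) ` D = cyc_edges vs"
    and D: "D \<subseteq> E"
    using assms(2) by (auto simp: is_cycle_iff)
  have inj: "inj_on (\<lambda>e. e \<inter> V) D"
    using plane_graph_inj_on_ends[OF pg] D by (rule inj_on_subset)
  have ce: "cyc_edges vs = insert {last vs, hd vs} (walk_edges vs)"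
    using vs(1) by (intro cyc_edges_conv_last) auto
  obtain e where e: "e \<in> D" "e \<inter> V = {last vs, hd vs}" using vs(4) ce by (metis image_iff insertI1)
  obtain g where g: "arc g" "path_image g = e" "pathstart g = last vs" "pathfinish g = hd vs"
    using plane_graph_edge_arc[OF pg _ e(2)] e(1) D by blast
  have im: "(\<lambda>e. e \<inter> V) ` (D - {e}) = walk_edges vs"
    using inj_on_image_set_diff[OF inj, of D "{e}"] e ce vs closing_edge_notin_walk_edges[of vs] by auto
  obtain h where h: "arc h" "path_image h = \<Union>(D - {e})" "pathstart h = hd vs" "pathfinish h = last vs"
    using plane_graph_walk_arc[OF pg _ vs(2) _ im] vs(1) D by auto
  have "e \<inter> \<Union>(D - {e}) \<subseteq> V"
    using plane_graph_Union_Int[OF pg, of "{e}" "D - {e}"] e D by auto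
  then have "path_image h \<inter> path_image g \<subseteq> {pathstart h, pathstart g}"
    using e(2) g h by auto
  then have "simple_path (h +++ g)" using g h by (intro simple_path_join_loop) auto
  moreover have "path_image (h +++ g) = \<Union>D"
    using g h e(1) by (auto simp: path_image_join)
  ultimately show ?thesis
    using g h that[of "h +++ g"] by auto
qed

section \<open>Topology of the drawing and its Jordan regions\<close>

text \<open>Invariance of dimension: on a nonempty interior the inverse of the arc would be a
  continuous injection of an open subset of the plane into the real line.\<close>

lemma interior_arc_image_empty:
  fixes g :: "real \<Rightarrow> complex"
  assumes "arc g"
  shows "interior (path_image g) = {}"
proof (rule ccontr)
  assume ne: "interior (path_image g) \<noteq> {}"
  obtain h where h: "homeomorphism {0..1} (path_image g) g h"
    using assms homeomorphism_compact[of "{0..1::real}" g "path_image g"]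
    unfolding arc_def path_def path_image_def by auto
  have "continuous_on (interior (path_image g)) h"
    using h interior_subset unfolding homeomorphism_def by (metis continuous_on_subset)
  moreover have "inj_on h (interior (path_image g))"
    using h interior_subset unfolding homeomorphism_def by (metis inj_on_def subsetD)
  ultimately have "DIM(complex) \<le> DIM(real)"
    using invariance_of_dimension[OF _ open_interior _ ne] by blast
  then show False by simp
qed

lemma plane_graph_compact:
  assumes "plane_graph V E"
  shows "compact (V \<union> \<Union>E)"
proof -
  have "compact e" if "e \<in> E" for e
    using assms that unfolding plane_graph_def by (metis compact_arc_image)
  then show ?thesis
    using assms unfolding plane_graph_def
    by (intro compact_Un compact_Union) (auto simp: finite_imp_compact)
qed

lemma interior_Union_closed_empty:
  fixes A :: "'a :: topological_space set set"
  assumes "finite A" "\<And>S. S \<in> A \<Longrightarrow> closed S \<and> interior S = {}"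
  shows "interior (\<Union>A) = {}"
  using assms
proof (induction A)
  case (insert S A)
  then show ?case
    using interior_closed_Un_empty_interior[of S "\<Union>A"] by auto
qed auto

text \<open>The drawing is a finite union of closed sets with empty interior. Hence every nonempty
  open set meets a face, which \<open>closure_Union_faces_Int\<close> exploits.\<close>

lemma plane_graph_interior_empty:
  assumes "plane_graph V E"
  shows "interior (V \<union> \<Union>E) = {}"
proof -
  have "closed e \<and> interior e = {}" if "e \<in> E" for e
    using assms that interior_arc_image_empty closed_arc_image unfolding plane_graph_def by metis
  then have "interior (\<Union>E) = {}"
    using assms unfolding plane_graph_def by (intro interior_Union_closed_empty) auto
  moreover have "closed V" "interior V = {}"
    using assms unfolding plane_graph_def
    by (auto simp: finite_imp_closed empty_interior_finite)
  ultimately show ?thesis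
    using interior_closed_Un_empty_interior by metis
qed

lemma is_cycle_Jordan:
  assumes "plane_graph V E" "is_cycle V E D"
  shows "open (inside (\<Union>D))" "connected (inside (\<Union>D))" "bounded (inside (\<Union>D))"
    "open (outside (\<Union>D))" "connected (outside (\<Union>D))" "\<not> bounded (outside (\<Union>D))"
    "frontier (inside (\<Union>D)) = \<Union>D" "frontier (outside (\<Union>D)) = \<Union>D"
proof -
  obtain g where g: "simple_path g" "pathfinish g = pathstart g" "path_image g = \<Union>D"
    using is_cycle_simple_path[OF assms] .
  show "open (inside (\<Union>D))" "connected (inside (\<Union>D))" "bounded (inside (\<Union>D))"
    "open (outside (\<Union>D))" "connected (outside (\<Union>D))" "\<not> bounded (outside (\<Union>D))"
    "frontier (inside (\<Union>D)) = \<Union>D" "frontier (outside (\<Union>D)) = \<Union>D"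
    using Jordan_inside_outside[OF g(1,2)] unfolding g(3) by blast+
qed

lemma connected_subset_of_disjoint_frontier:
  assumes "connected S" "S \<inter> T \<noteq> {}" "S \<inter> frontier T = {}"
  shows "S \<subseteq> T"
  using connected_Int_frontier[OF assms(1,2)] assms(3) by blast

text \<open>At a point of \<open>inside (c1 \<union> c)\<close> the curve \<open>c1 - c\<close> has winding number \<open>\<plusminus>1\<close> and \<open>c2 - c\<close> has
  winding number 0, so \<open>c1 - c2\<close> winds around that point.\<close>

lemma theta_disjoint_insides:
  fixes c :: "real \<Rightarrow> complex"
  assumes "arc c1" "pathstart c1 = a" "pathfinish c1 = b"
    and "arc c2" "pathstart c2 = a" "pathfinish c2 = b"
    and "arc c" "pathstart c = a" "pathfinish c = b"
    and "path_image c1 \<inter> path_image c2 = {a, b}" "path_image c1 \<inter> path_image c = {a, b}"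
      "path_image c2 \<inter> path_image c = {a, b}"
    and disj: "inside (path_image c1 \<union> path_image c) \<inter> inside (path_image c2 \<union> path_image c) = {}"
    and c2: "inside (path_image c1 \<union> path_image c) \<inter> path_image c2 = {}"
  shows "inside (path_image c1 \<union> path_image c) \<union> inside (path_image c2 \<union> path_image c) \<union>
      (path_image c - {a, b}) = inside (path_image c1 \<union> path_image c2)"
proof -
  have ab: "a \<noteq> b" using assms(7-9) arc_distinct_ends by metis
  have paths: "path c1" "path c2" "path c" using assms(1,4,7) by (auto simp: arc_imp_path)
  have sp: "simple_path (c1 +++ reversepath c)" "simple_path (c2 +++ reversepath c)"
      "simple_path (c1 +++ reversepath c2)"
    using assms by (auto intro!: simple_path_join_loop simp: arc_reversepath)
  have im: "path_image (c1 +++ reversepath c) = path_image c1 \<union> path_image c"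
      "path_image (c2 +++ reversepath c) = path_image c2 \<union> path_image c"
      "path_image (c1 +++ reversepath c2) = path_image c1 \<union> path_image c2"
    using assms by (auto simp: path_image_join)
  have sub: "inside (path_image c1 \<union> path_image c) \<subseteq> inside (path_image c1 \<union> path_image c2)"
  proof
    fix z assume z: "z \<in> inside (path_image c1 \<union> path_image c)"
    then have "z \<notin> path_image c1 \<union> path_image c" using inside_no_overlap by blast
    then have zn: "z \<notin> path_image c1" "z \<notin> path_image c2" "z \<notin> path_image c" using z c2 by auto
    have "winding_number (c1 +++ reversepath c) z \<in> {-1, 1}"
      using sp(1) by (rule simple_closed_path_winding_number_inside) (use z assms im in auto)
    then have "winding_number c1 z - winding_number c z \<noteq> 0"
      using zn paths assms by (auto simp: winding_number_join winding_number_reversepath)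
    moreover have "z \<in> outside (path_image c2 \<union> path_image c)"
      using z zn disj inside_Un_outside[of "path_image c2 \<union> path_image c"] by blast
    then have "winding_number (c2 +++ reversepath c) z = 0"
      using sp(2) assms im by (intro winding_number_zero_in_outside) (auto simp: simple_path_imp_path)
    then have "winding_number c2 z - winding_number c z = 0"
      using zn paths assms by (auto simp: winding_number_join winding_number_reversepath)
    moreover have "winding_number (c1 +++ reversepath c2) z = winding_number c1 z - winding_number c2 z"
      using zn paths assms by (auto simp: winding_number_join winding_number_reversepath)
    ultimately have "winding_number (c1 +++ reversepath c2) z \<noteq> 0" by auto
    then have "z \<notin> outside (path_image c1 \<union> path_image c2)"
      using winding_number_zero_in_outside[of "c1 +++ reversepath c2" z] sp(3) assms im
      by (auto simp: simple_path_imp_path)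
    then show "z \<in> inside (path_image c1 \<union> path_image c2)"
      using zn inside_Un_outside[of "path_image c1 \<union> path_image c2"] by blast
  qed
  have J1: "frontier (inside (path_image c1 \<union> path_image c)) = path_image c1 \<union> path_image c"
    using Jordan_inside_outside[OF sp(1)] assms im by auto
  have J3: "frontier (inside (path_image c1 \<union> path_image c2)) = path_image c1 \<union> path_image c2"
    using Jordan_inside_outside[OF sp(3)] assms im by auto
  \<comment> \<open>By \<open>sub\<close>, an inner point \<open>p\<close> of \<open>c\<close> is a
    limit of points inside the curve formed by \<open>c1\<close> and \<open>c2\<close>. As
    \<open>p\<close> is not on that curve, \<open>c\<close> enters its inside, which is what
    splitting the inside along \<open>c\<close> requires.\<close>
  have "infinite (path_image c)"
    using assms(7) by (meson arc_imp_simple_path simple_path_image_uncountable uncountable_infinite)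
  then obtain p where p: "p \<in> path_image c" "p \<noteq> a" "p \<noteq> b"
    by (metis finite.simps finite_subset insert_iff subsetI)
  have "p \<in> closure (inside (path_image c1 \<union> path_image c))"
    using J1 p unfolding frontier_def by blast
  then have "p \<in> closure (inside (path_image c1 \<union> path_image c2))"
    using sub closure_mono by blast
  moreover have "p \<notin> path_image c1 \<union> path_image c2" using p assms by blast
  ultimately have "p \<in> inside (path_image c1 \<union> path_image c2)"
    using J3 closure_Un_frontier by blast
  then have "path_image c \<inter> inside (path_image c1 \<union> path_image c2) \<noteq> {}" using p by blast
  then show ?thesis
    using split_inside_simple_closed_curve[of c1 a b c2 c] assms ab arc_imp_simple_path by metis
qed

section \<open>Faces of triangulated plane graphs\<close>

locale triangulation =  fixes V :: "complex set" and E :: "complex set set"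
  assumes tri: "triangulated_plane_graph V E"
begin

lemma pg: "plane_graph V E"
  using tri by (simp add: triangulated_plane_graph_def)

lemma face_cycle:
  assumes "F \<in> faces V E"
  shows "is_cycle V E (boundary_edges E F)" "card (boundary_edges E F) = 3"
    "frontier F = \<Union>(boundary_edges E F)"
  using assms tri by (auto simp: triangulated_plane_graph_def)

lemma boundary_edges_subset: "boundary_edges E F \<subseteq> E"
  by (auto simp: boundary_edges_def)

lemma finite_edges: "finite E" and finite_vertices: "finite V"
  using pg by (auto simp: plane_graph_def)

lemma face_basic:
  assumes "F \<in> faces V E"
  shows "open F" "connected F" "F \<noteq> {}" "F \<inter> (V \<union> \<Union>E) = {}"
proof -
  have "open (- (V \<union> \<Union>E))"
    using compact_imp_closed[OF plane_graph_compact[OF pg]] by (rule open_Compl)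
  then show "open F" using assms unfolding faces_def by (rule open_components)
  show "connected F" "F \<noteq> {}" using assms unfolding faces_def
    by (meson in_components_connected in_components_nonempty)+
  show "F \<inter> (V \<union> \<Union>E) = {}" using assms in_components_subset unfolding faces_def by blast
qed

lemma faces_disjoint: "F \<in> faces V E \<Longrightarrow> G \<in> faces V E \<Longrightarrow> F \<noteq> G \<Longrightarrow> F \<inter> G = {}"
  unfolding faces_def by (metis components_nonoverlap)

lemma Union_faces: "\<Union>(faces V E) = - (V \<union> \<Union>E)"
  unfolding faces_def by (rule Union_components)

text \<open>The face and each side of its boundary cycle are connected, avoid that cycle and have it
  as frontier. Two such sets that meet cannot leave each other, so they coincide.\<close>

lemma face_eq_inside_or_outside:
  assumes "F \<in> faces V E"
  shows "F = inside (\<Union>(boundary_edges E F)) \<or> F = outside (\<Union>(boundary_edges E F))"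
proof -
  let ?J = "\<Union>(boundary_edges E F)"
  note J = is_cycle_Jordan[OF pg face_cycle(1)[OF assms]]
  have FJ: "F \<inter> ?J = {}" using face_basic(4)[OF assms] boundary_edges_subset by blast
  have eq: "F = C" if "connected C" "frontier C = ?J" "C \<inter> ?J = {}" "F \<inter> C \<noteq> {}" for C
  proof
    show "F \<subseteq> C" using face_basic[OF assms] that FJ
      by (intro connected_subset_of_disjoint_frontier) auto
    show "C \<subseteq> F" using that face_cycle(3)[OF assms]
      by (intro connected_subset_of_disjoint_frontier) auto
  qed
  obtain z where z: "z \<in> F" using face_basic(3)[OF assms] by blast
  then have "z \<in> inside ?J \<union> outside ?J" using FJ unfolding inside_Un_outside by (simp add: disjoint_iff)
  then have "F \<inter> inside ?J \<noteq> {} \<or> F \<inter> outside ?J \<noteq> {}" using z by (metis UnE disjoint_iff)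
  then show ?thesis
    using eq[of "inside ?J"] eq[of "outside ?J"] J by auto
qed

lemma bounded_face_eq_inside:
  assumes "F \<in> faces V E" "bounded F"
  shows "F = inside (\<Union>(boundary_edges E F))"
  using face_eq_inside_or_outside[OF assms(1)] is_cycle_Jordan(6)[OF pg face_cycle(1)[OF assms(1)]] assms(2)
  by metis

text \<open>A face is determined by its boundary edges and the choice of inside or outside.\<close>

lemma finite_faces: "finite (faces V E)"
proof (rule finite_subset)
  show "faces V E \<subseteq> (\<lambda>D. inside (\<Union>D)) ` Pow E \<union> (\<lambda>D. outside (\<Union>D)) ` Pow E"
    using face_eq_inside_or_outside boundary_edges_subset by blast
qed (simp add: finite_edges)

lemma unbounded_face_unique:
  assumes "F \<in> faces V E" "G \<in> faces V E" "\<not> bounded F" "\<not> bounded G"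
  shows "F = G"
  using cobounded_unique_unbounded_components[of "- (V \<union> \<Union>E)" G F] assms
    compact_imp_bounded[OF plane_graph_compact[OF pg]] unfolding faces_def by simp

lemma unbounded_face_exists: "\<exists>F \<in> faces V E. \<not> bounded F"
proof (rule ccontr)
  assume "\<not> ?thesis"
  then have "bounded (- (V \<union> \<Union>E))"
    unfolding Union_faces[symmetric] using finite_faces by (auto intro: bounded_Union)
  then show False
    using compact_imp_bounded[OF plane_graph_compact[OF pg]] cobounded_imp_unbounded by blast
qed

section \<open>Incidence of edges and faces\<close>

lemma edge_inner_point:
  assumes "e \<in> E"
  obtains p where "p \<in> e" "p \<notin> V"
proof -
  obtain g where "arc g" "path_image g = e" using pg assms unfolding plane_graph_def by metis
  then have "infinite e"
    by (meson arc_imp_simple_path simple_path_image_uncountable uncountable_infinite)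
  then show ?thesis using that finite_vertices by (meson finite_subset subsetI)
qed

text \<open>One non-vertex point decides for its whole edge: the frontier is a union of edges, and
  such a point lies on only one edge.\<close>

lemma boundary_edge_iff_frontier:
  assumes "F \<in> faces V E" "e \<in> E" "p \<in> e" "p \<notin> V"
  shows "e \<in> boundary_edges E F \<longleftrightarrow> p \<in> frontier F"
proof
  assume "p \<in> frontier F"
  then obtain f where "f \<in> boundary_edges E F" "p \<in> f" using face_cycle(3)[OF assms(1)] by blast
  then show "e \<in> boundary_edges E F"
    using plane_graph_edge_eqI[OF pg assms(2) _ assms(3)] boundary_edges_subset assms(4) by blast
qed (use assms in \<open>auto simp: boundary_edges_def\<close>)

text \<open>Deleting the drawing from an open set does not change its closure, since the drawing has
  empty interior. What remains is a finite union of pieces \<open>U \<inter> F\<close>, and closure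
  commutes with finite unions.\<close>

lemma closure_Union_faces_Int:
  assumes "open U" "p \<in> closure U"
  obtains F where "F \<in> faces V E" "p \<in> closure F" "F \<inter> U \<noteq> {}"
proof -
  have "closure (U \<inter> - (V \<union> \<Union>E)) = closure U"
    using assms(1)
    by (rule closure_open_Int_superset) (simp only: closure_complement plane_graph_interior_empty[OF pg], simp)
  moreover have "U \<inter> - (V \<union> \<Union>E) = (\<Union>F\<in>faces V E. U \<inter> F)"
    unfolding Union_faces[symmetric] by (rule Int_Union)
  ultimately have "p \<in> closure (\<Union>F\<in>faces V E. U \<inter> F)"
    using assms(2) by simp
  moreover have "closure (\<Union>F\<in>faces V E. U \<inter> F) \<subseteq> (\<Union>F\<in>faces V E. closure (U \<inter> F))"
    using finite_faces by (intro closure_minimal closed_UN UN_mono closure_subset) auto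
  ultimately obtain F where F: "F \<in> faces V E" "p \<in> closure (U \<inter> F)" by blast
  then have "p \<in> closure F" "F \<inter> U \<noteq> {}"
    using closure_mono[of "U \<inter> F" F] by (auto simp: Int_commute)
  then show ?thesis using that F by blast
qed

text \<open>Finds a face at \<open>e\<close> on a prescribed side: \<open>U\<close> will be the
  inside or outside of a cycle, or the whole plane.\<close>

lemma edge_face_meeting:
  assumes "open U" "p \<in> closure U" "e \<in> E" "p \<in> e" "p \<notin> V"
  obtains F where "F \<in> faces V E" "e \<in> boundary_edges E F" "F \<inter> U \<noteq> {}"
proof -
  obtain F where F: "F \<in> faces V E" "p \<in> closure F" "F \<inter> U \<noteq> {}"
    using closure_Union_faces_Int[OF assms(1,2)] .
  moreover have "p \<notin> F" using face_basic(4)[OF F(1)] assms(3,4) by blast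
  ultimately have "p \<in> frontier F"
    using face_basic(1)[OF F(1)] by (simp add: frontier_def interior_open)
  then show ?thesis using that F boundary_edge_iff_frontier[OF F(1) assms(3-5)] by blast
qed

lemma face_side:
  assumes "is_cycle V E D" "F \<in> faces V E"
  shows "F \<inter> inside (\<Union>D) \<noteq> {} \<Longrightarrow> F \<subseteq> inside (\<Union>D)"
    and "F \<inter> outside (\<Union>D) \<noteq> {} \<Longrightarrow> F \<subseteq> outside (\<Union>D)"
proof -
  have "\<Union>D \<subseteq> \<Union>E" using is_cycle_subset[OF assms(1)] by (rule Union_mono)
  then have "F \<inter> \<Union>D = {}" using face_basic(4)[OF assms(2)] by blast
  then show "F \<inter> inside (\<Union>D) \<noteq> {} \<Longrightarrow> F \<subseteq> inside (\<Union>D)"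
    "F \<inter> outside (\<Union>D) \<noteq> {} \<Longrightarrow> F \<subseteq> outside (\<Union>D)"
    using is_cycle_Jordan(7,8)[OF pg assms(1)] face_basic(2)[OF assms(2)]
    by (metis connected_subset_of_disjoint_frontier)+
qed

text \<open>Every point of a cycle edge is a limit of both Jordan regions, so each region contains a
  face at that edge.\<close>

lemma cycle_edge_faces:
  assumes "is_cycle V E D" "e \<in> D"
  obtains F G where "F \<in> faces V E" "e \<in> boundary_edges E F" "F \<subseteq> inside (\<Union>D)"
    "G \<in> faces V E" "e \<in> boundary_edges E G" "G \<subseteq> outside (\<Union>D)"
proof -
  note J = is_cycle_Jordan[OF pg assms(1)]
  have e: "e \<in> E" using is_cycle_subset assms by blast
  obtain p where p: "p \<in> e" "p \<notin> V" using edge_inner_point[OF e] .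
  have "p \<in> closure (inside (\<Union>D))" "p \<in> closure (outside (\<Union>D))"
    using J(7,8) p assms(2) unfolding frontier_def by blast+
  then show ?thesis
    using edge_face_meeting[OF J(1) _ e p] edge_face_meeting[OF J(4) _ e p] face_side[OF assms(1)] that
    by metis
qed

text \<open>An inner point of \<open>e\<close> lies off the cycle, hence in one of its open regions.
  Every face with \<open>e\<close> on its frontier meets that region and so is contained in
  it.\<close>

lemma noncycle_edge_faces:
  assumes "is_cycle V E D" "e \<in> E" "e \<notin> D"
    and F: "F \<in> faces V E" "e \<in> boundary_edges E F" and G: "G \<in> faces V E" "e \<in> boundary_edges E G"
  shows "F \<subseteq> inside (\<Union>D) \<longleftrightarrow> G \<subseteq> inside (\<Union>D)"
proof -
  note J = is_cycle_Jordan[OF pg assms(1)]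
  obtain p where p: "p \<in> e" "p \<notin> V" using edge_inner_point[OF assms(2)] .
  have "p \<notin> \<Union>D"
    using plane_graph_edge_eqI[OF pg assms(2) _ p(1) _ p(2)] is_cycle_subset[OF assms(1)] assms(3)
    by (metis UnionE subsetD)
  then have "p \<in> inside (\<Union>D) \<union> outside (\<Union>D)" unfolding inside_Un_outside by simp
  then have side: "p \<in> inside (\<Union>D) \<or> p \<in> outside (\<Union>D)" by (rule UnE) simp_all
  have meets: "H \<inter> U \<noteq> {}" if "H \<in> faces V E" "e \<in> boundary_edges E H" "open U" "p \<in> U" for H U
  proof -
    have "p \<in> closure H" using that p unfolding boundary_edges_def frontier_def by blast
    then show ?thesis using that(3,4) open_Int_closure_eq_empty[of U H] by blast
  qed
  have ne: "F \<noteq> {}" "G \<noteq> {}" using face_basic(3) F G by auto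
  from side show ?thesis
  proof
    assume "p \<in> inside (\<Union>D)"
    then show ?thesis using meets J(1) face_side(1)[OF assms(1)] F G by blast
  next
    assume "p \<in> outside (\<Union>D)"
    then have "F \<subseteq> outside (\<Union>D)" "G \<subseteq> outside (\<Union>D)"
      using meets J(4) face_side(2)[OF assms(1)] F G by blast+
    then show ?thesis using ne inside_Int_outside by blast
  qed
qed

text \<open>The edge \<open>e\<close> and the two-edge paths completing the triangles form a theta
  graph. The inside of the outer quadrilateral serves as \<open>U\<close>; by
  \<open>theta_disjoint_insides\<close> it consists of \<open>F\<close>, \<open>G\<close> and the
  interior of \<open>e\<close>. This will exclude a third face at \<open>e\<close>.\<close>

lemma bounded_faces_at_edge:
  assumes F: "F \<in> faces V E" "e \<in> boundary_edges E F" "bounded F"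
    and G: "G \<in> faces V E" "e \<in> boundary_edges E G" "bounded G"
    and "F \<noteq> G"
  obtains U where "open U" "e - V \<subseteq> U" "U \<subseteq> F \<union> G \<union> e"
proof -
  have e: "e \<in> E" using F(2) boundary_edges_subset by blast
  obtain x y where xy: "e \<inter> V = {x, y}" using plane_graph_edge_ends[OF pg e] by blast
  obtain w1 q1 r1 where 1: "boundary_edges E F = {e, q1, r1}" "q1 \<inter> V = {x, w1}" "r1 \<inter> V = {y, w1}"
    "w1 \<in> V" "w1 \<noteq> x" "w1 \<noteq> y" "x \<noteq> y"
    using is_cycle_triangle[OF pg face_cycle(1,2)[OF F(1)] F(2) xy] .
  obtain w2 q2 r2 where 2: "boundary_edges E G = {e, q2, r2}" "q2 \<inter> V = {x, w2}" "r2 \<inter> V = {y, w2}"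
    "w2 \<in> V" "w2 \<noteq> x" "w2 \<noteq> y"
    using is_cycle_triangle[OF pg face_cycle(1,2)[OF G(1)] G(2) xy] by metis
  have E1: "q1 \<in> E" "r1 \<in> E" and E2: "q2 \<in> E" "r2 \<in> E"
    using boundary_edges_subset[of F] boundary_edges_subset[of G] unfolding 1(1) 2(1) by simp_all
  note inj = inj_onD[OF plane_graph_inj_on_ends[OF pg]]
  \<comment> \<open>With a common third vertex both triangles would have the same edges, and a
    bounded face is the inside of its boundary.\<close>
  have "w1 \<noteq> w2"
  proof
    assume "w1 = w2"
    then have "q1 \<inter> V = q2 \<inter> V" "r1 \<inter> V = r2 \<inter> V" using 1(2,3) 2(2,3) by simp_all
    then have "q1 = q2" "r1 = r2" using inj E1 E2 by blast+
    then show False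
      using bounded_face_eq_inside[OF F(1,3)] bounded_face_eq_inside[OF G(1,3)] 1(1) 2(1) assms(7) by simp
  qed
  obtain c where c: "arc c" "path_image c = e" "pathstart c = x" "pathfinish c = y"
    using plane_graph_edge_arc[OF pg e xy] .
  have "(\<lambda>e. e \<inter> V) ` {q1, r1} = walk_edges [x, w1, y]" using 1 by (simp add: insert_commute)
  then obtain c1 where c1: "arc c1" "path_image c1 = \<Union>{q1, r1}" "pathstart c1 = x" "pathfinish c1 = y"
    using plane_graph_walk_arc[OF pg, of "[x, w1, y]" "{q1, r1}"] 1(5-7) E1 by auto
  have "(\<lambda>e. e \<inter> V) ` {q2, r2} = walk_edges [x, w2, y]" using 2 by (simp add: insert_commute)
  then obtain c2 where c2: "arc c2" "path_image c2 = \<Union>{q2, r2}" "pathstart c2 = x" "pathfinish c2 = y"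
    using plane_graph_walk_arc[OF pg, of "[x, w2, y]" "{q2, r2}"] 1(7) 2(5,6) E2 by auto
  have V1: "path_image c1 \<inter> V = {x, w1, y}" and V2: "path_image c2 \<inter> V = {x, w2, y}"
    and Vc: "path_image c \<inter> V = {x, y}"
    using 1(2,3) 2(2,3) xy unfolding c1(2) c2(2) c(2) by auto
  have ne: "q1 \<noteq> q2" "q1 \<noteq> r2" "r1 \<noteq> q2" "r1 \<noteq> r2" "q1 \<noteq> e" "r1 \<noteq> e" "q2 \<noteq> e" "r2 \<noteq> e"
    using 1(2-7) 2(2-6) xy \<open>w1 \<noteq> w2\<close> by (metis doubleton_eq_iff)+
  have Int_eq: "A \<inter> B = {x, y}" if "A \<inter> B \<subseteq> V" "A \<inter> V = {x, u, y}" "B \<inter> V = S" "u \<notin> S" "x \<in> S" "y \<in> S"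
    for A B S :: "complex set" and u
  proof -
    have "A \<inter> B = (A \<inter> V) \<inter> (B \<inter> V)" using that(1) by blast
    then show ?thesis unfolding that(2,3) using that(4-6) by auto
  qed
  have "path_image c1 \<inter> path_image c2 \<subseteq> V"
    unfolding c1(2) c2(2) using E1 E2 ne by (intro plane_graph_Union_Int[OF pg]) auto
  then have I12: "path_image c1 \<inter> path_image c2 = {x, y}"
    by (rule Int_eq[OF _ V1 V2]) (use \<open>w1 \<noteq> w2\<close> 1(5,6) in auto)
  have "\<Union>{q1, r1} \<inter> \<Union>{e} \<subseteq> V" "\<Union>{q2, r2} \<inter> \<Union>{e} \<subseteq> V"
    using E1 E2 ne e by (intro plane_graph_Union_Int[OF pg]; auto)+
  then have "path_image c1 \<inter> path_image c \<subseteq> V" "path_image c2 \<inter> path_image c \<subseteq> V"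
    unfolding c1(2) c2(2) c(2) by auto
  then have I1: "path_image c1 \<inter> path_image c = {x, y}" and I2: "path_image c2 \<inter> path_image c = {x, y}"
    using Int_eq[OF _ V1 Vc] Int_eq[OF _ V2 Vc] 1(5,6) 2(5,6) by simp_all
  have "\<Union>(boundary_edges E F) = path_image c1 \<union> path_image c"
    "\<Union>(boundary_edges E G) = path_image c2 \<union> path_image c"
    unfolding 1(1) 2(1) c1(2) c2(2) c(2) by auto
  then have Fin: "F = inside (path_image c1 \<union> path_image c)" and Gin: "G = inside (path_image c2 \<union> path_image c)"
    using bounded_face_eq_inside[OF F(1,3)] bounded_face_eq_inside[OF G(1,3)] by auto
  have "F \<inter> path_image c2 = {}"
    using face_basic(4)[OF F(1)] E2 unfolding c2(2) by auto
  then have eq: "F \<union> G \<union> (e - {x, y}) = inside (path_image c1 \<union> path_image c2)"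
    using theta_disjoint_insides[OF c1(1,3,4) c2(1,3,4) c(1,3,4) I12 I1 I2]
      faces_disjoint[OF F(1) G(1) assms(7)] Fin Gin c(2) by auto
  have "open (inside (path_image c1 \<union> path_image c2))"
    using c1 c2 by (intro open_inside closed_Un closed_arc_image) auto
  then show ?thesis using that eq xy by blast
qed

text \<open>The boundary cycle of some face at \<open>e\<close> has a face at \<open>e\<close> on
  each side, so there are at least two. Among three faces at least two are bounded, and the
  neighbourhood of \<open>e\<close> that these two fill leaves no room for the third.\<close>

lemma edge_faces:
  assumes "e \<in> E"
  obtains F G where "F \<in> faces V E" "G \<in> faces V E" "F \<noteq> G"
    "\<And>H. H \<in> faces V E \<Longrightarrow> e \<in> boundary_edges E H \<longleftrightarrow> H = F \<or> H = G"
proof -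
  obtain p where p: "p \<in> e" "p \<notin> V" using edge_inner_point[OF assms] .
  obtain F0 where F0: "F0 \<in> faces V E" "e \<in> boundary_edges E F0"
    using edge_face_meeting[of UNIV p e] assms p by auto
  obtain F G where FG: "F \<in> faces V E" "e \<in> boundary_edges E F" "F \<subseteq> inside (\<Union>(boundary_edges E F0))"
    "G \<in> faces V E" "e \<in> boundary_edges E G" "G \<subseteq> outside (\<Union>(boundary_edges E F0))"
    using cycle_edge_faces[OF face_cycle(1)[OF F0(1)] F0(2)] .
  have "F \<noteq> G" using FG face_basic(3) inside_Int_outside by blast
  have False if H: "H1 \<in> faces V E" "H2 \<in> faces V E" "H3 \<in> faces V E"
    "e \<in> boundary_edges E H1" "e \<in> boundary_edges E H2" "e \<in> boundary_edges E H3"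
    "H1 \<noteq> H2" "H1 \<noteq> H3" "H2 \<noteq> H3" "bounded H1" "bounded H2" for H1 H2 H3
  proof -
    obtain U where U: "open U" "e - V \<subseteq> U" "U \<subseteq> H1 \<union> H2 \<union> e"
      using bounded_faces_at_edge[OF H(1,4,10) H(2,5,11) H(7)] .
    have "p \<in> closure H3" using H(3,6) p unfolding boundary_edges_def frontier_def by blast
    then have "H3 \<inter> U \<noteq> {}" using U(1,2) p open_Int_closure_eq_empty[of U H3] by blast
    moreover have "H3 \<inter> H1 = {}" "H3 \<inter> H2 = {}" "H3 \<inter> e = {}"
      using faces_disjoint H face_basic(4)[OF H(3)] assms by auto
    ultimately show False using U(3) by blast
  qed
  then have "H = F \<or> H = G" if "H \<in> faces V E" "e \<in> boundary_edges E H" for H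
    using that FG \<open>F \<noteq> G\<close> unbounded_face_unique by metis
  then show ?thesis using that[of F G] FG \<open>F \<noteq> G\<close> by blast
qed

end

section \<open>Boundaries of sets of faces\<close>

lemma even_card_sym_diff:
  assumes "finite A" "finite B"
  shows "even (card (sym_diff A B)) \<longleftrightarrow> (even (card A) \<longleftrightarrow> even (card B))"
proof -
  have "card (sym_diff A B) = card (A - B) + card (B - A)"
    using assms by (intro card_Un_disjoint) auto
  moreover have "card A = card (A - B) + card (A \<inter> B)"
    using assms by (metis add.commute card_Int_Diff)
  moreover have "card B = card (B - A) + card (A \<inter> B)"
    using assms by (metis add.commute card_Int_Diff Int_commute)
  ultimately show ?thesis by presburger
qed

context triangulation
begin

text \<open>The boundary map modulo 2 from sets of faces to sets of edges;
  \<open>bdry_sym_diff\<close> is its additivity.\<close>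

definition bdry :: "complex set set \<Rightarrow> complex set set" where
  "bdry S = {e \<in> E. \<exists>F\<in>S. \<exists>G\<in>faces V E - S. e \<in> boundary_edges E F \<and> e \<in> boundary_edges E G}"

lemma bdry_subset: "bdry S \<subseteq> E"
  by (auto simp: bdry_def)

text \<open>The same two faces serve for all \<open>S\<close>, so identities between boundaries
  reduce to propositional logic at each edge.\<close>

lemma edge_faces_bdry:
  assumes "e \<in> E"
  obtains F G where "F \<in> faces V E" "G \<in> faces V E" "F \<noteq> G"
    "\<And>H. H \<in> faces V E \<Longrightarrow> e \<in> boundary_edges E H \<longleftrightarrow> H = F \<or> H = G"
    "\<And>S. S \<subseteq> faces V E \<Longrightarrow> e \<in> bdry S \<longleftrightarrow> (F \<in> S \<longleftrightarrow> G \<notin> S)"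
proof -
  obtain F G where FG: "F \<in> faces V E" "G \<in> faces V E" "F \<noteq> G"
    "\<And>H. H \<in> faces V E \<Longrightarrow> e \<in> boundary_edges E H \<longleftrightarrow> H = F \<or> H = G"
    using edge_faces[OF assms] by blast
  have "e \<in> bdry S \<longleftrightarrow> (F \<in> S \<longleftrightarrow> G \<notin> S)" if "S \<subseteq> faces V E" for S
  proof -
    have "e \<in> bdry S \<longleftrightarrow> (\<exists>H\<in>S. \<exists>K\<in>faces V E - S. (H = F \<or> H = G) \<and> (K = F \<or> K = G))"
      unfolding bdry_def using assms FG(4) that by (auto simp: subset_iff)
    then show ?thesis using FG(1-3) by auto
  qed
  then show ?thesis using that FG by blast
qed

lemma bdry_sym_diff:
  assumes "S \<subseteq> faces V E" "T \<subseteq> faces V E"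
  shows "bdry (sym_diff S T) = sym_diff (bdry S) (bdry T)"
proof -
  have "e \<in> bdry (sym_diff S T) \<longleftrightarrow> e \<in> sym_diff (bdry S) (bdry T)" if e: "e \<in> E" for e
  proof -
    obtain F G where "F \<in> faces V E" "G \<in> faces V E" "F \<noteq> G"
      "\<And>H. H \<in> faces V E \<Longrightarrow> e \<in> boundary_edges E H \<longleftrightarrow> H = F \<or> H = G"
      and iff: "\<And>S. S \<subseteq> faces V E \<Longrightarrow> e \<in> bdry S \<longleftrightarrow> (F \<in> S \<longleftrightarrow> G \<notin> S)"
      by (rule edge_faces_bdry[OF e]) blast
    have "sym_diff S T \<subseteq> faces V E" using assms by blast
    then show ?thesis using iff assms by auto
  qed
  then show ?thesis using bdry_subset by blast
qed

lemma bdry_Diff_faces: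
  assumes "S \<subseteq> faces V E"
  shows "bdry (faces V E - S) = bdry S"
  using assms unfolding bdry_def by blast

lemma bdry_singleton:
  assumes "F \<in> faces V E"
  shows "bdry {F} = boundary_edges E F"
proof -
  have "e \<in> bdry {F} \<longleftrightarrow> e \<in> boundary_edges E F" if e: "e \<in> E" for e
  proof -
    obtain G H where "G \<in> faces V E" "H \<in> faces V E" and GH: "G \<noteq> H"
      "\<And>K. K \<in> faces V E \<Longrightarrow> e \<in> boundary_edges E K \<longleftrightarrow> K = G \<or> K = H"
      "\<And>S. S \<subseteq> faces V E \<Longrightarrow> e \<in> bdry S \<longleftrightarrow> (G \<in> S \<longleftrightarrow> H \<notin> S)"
      by (rule edge_faces_bdry[OF e]) blast
    show ?thesis using GH(1) GH(2)[OF assms] GH(3)[of "{F}"] assms by auto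
  qed
  then show ?thesis using bdry_subset boundary_edges_subset by blast
qed

lemma bdry_empty: "bdry {} = {}"
  by (simp add: bdry_def)

lemma bdry_Int_subset: "bdry (S \<inter> T) \<subseteq> bdry S \<union> bdry T"
  unfolding bdry_def by blast

lemma bdry_Un_disjoint:
  assumes "S \<subseteq> faces V E" "T \<subseteq> faces V E" "S \<inter> T = {}"
  shows "bdry (S \<union> T) = sym_diff (bdry S) (bdry T)"
proof -
  have "sym_diff S T = S \<union> T" using assms(3) by blast
  then show ?thesis using bdry_sym_diff[OF assms(1,2)] by simp
qed

lemma bdry_remove:
  assumes "S \<subseteq> faces V E" "F \<in> S"
  shows "bdry (S - {F}) = sym_diff (bdry S) (boundary_edges E F)"
proof -
  have "sym_diff S {F} = S - {F}" using assms(2) by blast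
  then show ?thesis using bdry_sym_diff[of S "{F}"] bdry_singleton[of F] assms by auto
qed

lemma face_even_degree:
  assumes "F \<in> faces V E" "v \<in> V"
  shows "even (card {e \<in> boundary_edges E F. v \<in> e})"
proof -
  obtain p where p: "p \<in> boundary_edges E F"
    using is_cycle_nonempty[OF face_cycle(1)[OF assms(1)]] by blast
  then obtain x y where xy: "p \<inter> V = {x, y}" "x \<noteq> y"
    using plane_graph_edge_ends[OF pg] boundary_edges_subset by (metis subsetD)
  obtain w q r where t: "boundary_edges E F = {p, q, r}" "q \<inter> V = {x, w}" "r \<inter> V = {y, w}"
    "w \<noteq> x" "w \<noteq> y"
    using is_cycle_triangle[OF pg face_cycle(1,2)[OF assms(1)] p xy(1)] by metis
  have vi: "v \<in> f \<longleftrightarrow> v \<in> f \<inter> V" for f using assms(2) by simp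
  have mem: "v \<in> p \<longleftrightarrow> v = x \<or> v = y" "v \<in> q \<longleftrightarrow> v = x \<or> v = w" "v \<in> r \<longleftrightarrow> v = y \<or> v = w"
    using vi[of p] vi[of q] vi[of r] unfolding xy(1) t(2,3) by simp_all
  have ne: "p \<noteq> q" "p \<noteq> r" "q \<noteq> r"
    using xy t(2-5) by (metis doubleton_eq_iff)+
  consider "v = x" | "v = y" | "v = w" | "v \<noteq> x" "v \<noteq> y" "v \<noteq> w" by blast
  then show ?thesis
  proof cases
    case 1
    then have "{e \<in> {p, q, r}. v \<in> e} = {p, q}" using mem xy t(4,5) by auto
    then show ?thesis using ne t(1) by simp
  next
    case 2
    then have "{e \<in> {p, q, r}. v \<in> e} = {p, r}" using mem xy t(4,5) by auto
    then show ?thesis using ne t(1) by simp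
  next
    case 3
    then have "{e \<in> {p, q, r}. v \<in> e} = {q, r}" using mem xy t(4,5) by auto
    then show ?thesis using ne t(1) by simp
  next
    case 4
    then have "{e \<in> {p, q, r}. v \<in> e} = {}" using mem by auto
    then show ?thesis using t(1) by (simp only: card.empty even_zero)
  qed
qed

text \<open>Each triangle has even degree at every vertex, and the parity of degrees is additive
  under symmetric difference.\<close>

lemma bdry_even_degree:
  assumes "S \<subseteq> faces V E" "v \<in> V"
  shows "even (card {e \<in> bdry S. v \<in> e})"
proof -
  have "finite S" using assms(1) finite_faces by (rule finite_subset)
  then show ?thesis using assms(1)
  proof (induction S)
    case empty
    then show ?case by (simp add: bdry_empty)
  next
    case (insert F S)
    have "bdry (insert F S) = sym_diff (bdry S) (boundary_edges E F)"
      using bdry_Un_disjoint[of S "{F}"] bdry_singleton[of F] insert by auto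
    then have eq: "{e \<in> bdry (insert F S). v \<in> e}
        = sym_diff {e \<in> bdry S. v \<in> e} {e \<in> boundary_edges E F. v \<in> e}"
      by blast
    have fin: "finite {e \<in> bdry S. v \<in> e}" "finite {e \<in> boundary_edges E F. v \<in> e}"
      by (rule finite_subset[OF _ finite_edges]; use bdry_subset boundary_edges_subset in blast)+
    show ?case
      unfolding eq even_card_sym_diff[OF fin] using face_even_degree[OF _ assms(2), of F] insert by simp
  qed
qed

text \<open>The closed sets \<open>A\<close> and \<open>B\<close> cover the plane off
  \<open>V\<close>. A common point that is not a vertex would lie on an edge separating the two
  families, so they would disconnect the complement of the finite set \<open>V\<close>.\<close>

lemma bdry_eq_empty:
  assumes "S \<subseteq> faces V E" "bdry S = {}"
  shows "S = {} \<or> S = faces V E"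
proof (rule ccontr)
  assume nontriv: "\<not> ?thesis"
  define A where "A = (\<Union>F\<in>S. closure F)"
  define B where "B = (\<Union>F\<in>faces V E - S. closure F)"
  have fin: "finite S" "finite (faces V E - S)"
    using finite_faces assms(1) finite_subset by auto
  have closed: "closed A" "closed B"
    unfolding A_def B_def using fin by (auto intro: closed_UN)
  have cover: "- V \<subseteq> A \<union> B"
  proof
    fix p assume "p \<in> - V"
    obtain F where "F \<in> faces V E" "p \<in> closure F"
      using closure_Union_faces_Int[of UNIV p] by auto
    then show "p \<in> A \<union> B" unfolding A_def B_def by blast
  qed
  have disj: "A \<inter> B \<inter> - V = {}"
  proof (rule ccontr)
    assume "A \<inter> B \<inter> - V \<noteq> {}"
    then obtain p F G where p: "p \<notin> V" and F: "F \<in> S" "p \<in> closure F"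
      and G: "G \<in> faces V E - S" "p \<in> closure G"
      unfolding A_def B_def by blast
    have FG: "F \<in> faces V E" "G \<in> faces V E" "F \<noteq> G" using F G assms(1) by auto
    have o: "open F" "open G" using face_basic(1) FG by auto
    have "F \<inter> G = {}" using faces_disjoint[OF FG] .
    then have "p \<notin> F" "p \<notin> G"
      using F(2) G(2) o open_Int_closure_eq_empty[of F G] open_Int_closure_eq_empty[of G F] by blast+
    then have fr: "p \<in> frontier F" "p \<in> frontier G"
      using F(2) G(2) o by (auto simp: frontier_def interior_open)
    then obtain e where e: "e \<in> boundary_edges E F" "p \<in> e" using face_cycle(3)[OF FG(1)] by blast
    then have "e \<in> E" using boundary_edges_subset by blast
    moreover have "e \<in> boundary_edges E G"
      using boundary_edge_iff_frontier[OF FG(2) \<open>e \<in> E\<close> e(2) p] fr by blast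
    ultimately have "e \<in> bdry S" unfolding bdry_def using e F(1) G(1) by blast
    then show False using assms(2) by blast
  qed
  have meets: "\<Union>T \<inter> - V \<noteq> {}" if "T \<subseteq> faces V E" "T \<noteq> {}" for T
    using that face_basic(3,4) by blast
  have "\<Union>S \<subseteq> A" "\<Union>(faces V E - S) \<subseteq> B"
    unfolding A_def B_def using closure_subset by blast+
  moreover have "\<Union>S \<inter> - V \<noteq> {}" "\<Union>(faces V E - S) \<inter> - V \<noteq> {}"
    using meets[of S] meets[of "faces V E - S"] nontriv assms(1) by blast+
  ultimately have "A \<inter> - V \<noteq> {}" "B \<inter> - V \<noteq> {}" by blast+
  moreover have "connected (- V)"
    using finite_vertices
    by (intro path_connected_imp_connected path_connected_complement_countable) (auto simp: countable_finite)
  ultimately show False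
    using closed cover disj unfolding connected_closed by blast
qed

lemma bdry_eq_iff:
  assumes "S \<subseteq> faces V E" "T \<subseteq> faces V E" "bdry S = bdry T"
  shows "S = T \<or> S = faces V E - T"
proof -
  have "bdry (sym_diff S T) = {}" using bdry_sym_diff[OF assms(1,2)] assms(3) by simp
  then have "sym_diff S T = {} \<or> sym_diff S T = faces V E"
    using bdry_eq_empty[of "sym_diff S T"] assms(1,2) by blast
  then show ?thesis using assms(1,2) by blast
qed

lemma bdry_subset_cycle:
  assumes "S \<subseteq> faces V E" "T \<subseteq> faces V E" "is_cycle V E (bdry S)" "bdry T \<subseteq> bdry S"
  shows "T = {} \<or> T = faces V E \<or> T = S \<or> T = faces V E - S"
  using is_cycle_even_subset[OF pg assms(3,4) bdry_even_degree[OF assms(2)]]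
    bdry_eq_empty[OF assms(2)] bdry_eq_iff[OF assms(2,1)] by blast

text \<open>The faces inside the Jordan curve work: a cycle edge has a face on each side, and the
  two faces at any other edge lie on the same side.\<close>

lemma cycle_eq_bdry:
  assumes "is_cycle V E D"
  obtains S where "S \<subseteq> faces V E" "bdry S = D"
proof -
  define S where "S = {F \<in> faces V E. F \<subseteq> inside (\<Union>D)}"
  have S: "S \<subseteq> faces V E" by (auto simp: S_def)
  have "e \<in> bdry S \<longleftrightarrow> e \<in> D" if e: "e \<in> E" for e
  proof -
    obtain F G where FG: "F \<in> faces V E" "G \<in> faces V E" "F \<noteq> G"
      "\<And>H. H \<in> faces V E \<Longrightarrow> e \<in> boundary_edges E H \<longleftrightarrow> H = F \<or> H = G"
      "\<And>S. S \<subseteq> faces V E \<Longrightarrow> e \<in> bdry S \<longleftrightarrow> (F \<in> S \<longleftrightarrow> G \<notin> S)"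
      by (rule edge_faces_bdry[OF e]) blast
    show ?thesis
    proof (cases "e \<in> D")
      case True
      obtain H K where HK: "H \<in> faces V E" "e \<in> boundary_edges E H" "H \<subseteq> inside (\<Union>D)"
        "K \<in> faces V E" "e \<in> boundary_edges E K" "K \<subseteq> outside (\<Union>D)"
        using cycle_edge_faces[OF assms True] .
      have "K \<inter> inside (\<Union>D) = {}" using HK(6) inside_Int_outside[of "\<Union>D"] by blast
      then have "H \<in> S" "K \<notin> S" using HK face_basic(3)[of K] unfolding S_def by auto
      then show ?thesis using True FG(4)[OF HK(1)] FG(4)[OF HK(4)] FG(5)[OF S] HK(2,5) by auto
    next
      case False
      have "F \<in> S \<longleftrightarrow> G \<in> S"
        using noncycle_edge_faces[OF assms e False FG(1) _ FG(2)] FG(1,2,4) unfolding S_def by auto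
      then show ?thesis using False FG(5)[OF S] by auto
    qed
  qed
  then have "bdry S = D" using bdry_subset is_cycle_subset[OF assms] by blast
  then show ?thesis using that S by blast
qed

end

section \<open>Removing faces one at a time\<close>

context triangulation
begin

text \<open>The chord closes up two cycles, bounding \<open>S1\<close> and \<open>S2\<close> with
  symmetric difference \<open>S\<close>. Their overlap has its boundary inside the cycle
  \<open>bdry S\<close>, so it is empty or the complement of \<open>S\<close>; in the latter case
  both sets are complemented.\<close>

lemma chord_split:
  assumes S: "S \<subseteq> faces V E" and cyc: "is_cycle V E (bdry S)"
    and e: "e \<in> E" "e \<notin> bdry S" "e \<inter> V \<subseteq> \<Union>(bdry S)" and F: "F \<in> S" "e \<in> boundary_edges E F"
  obtains S1 S2 where "S1 \<union> S2 = S" "S1 \<inter> S2 = {}" "is_cycle V E (bdry S1)" "is_cycle V E (bdry S2)"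
    "bdry S1 \<inter> bdry S2 = {e}"
proof -
  obtain D1 D2 where D: "is_cycle V E D1" "is_cycle V E D2" "D1 \<union> D2 = insert e (bdry S)" "D1 \<inter> D2 = {e}"
    using is_cycle_chord[OF pg cyc e] .
  obtain S1 where S1: "S1 \<subseteq> faces V E" "bdry S1 = D1" using cycle_eq_bdry[OF D(1)] .
  obtain S2' where S2': "S2' \<subseteq> faces V E" "bdry S2' = D2" using cycle_eq_bdry[OF D(2)] .
  have "sym_diff D1 D2 = (D1 \<union> D2) - (D1 \<inter> D2)" by blast
  then have "sym_diff D1 D2 = bdry S" unfolding D(3,4) using e(2) by simp
  then have "bdry (sym_diff S1 S2') = bdry S" using bdry_sym_diff[OF S1(1) S2'(1)] S1(2) S2'(2) by simp
  moreover have "sym_diff S1 S2' \<subseteq> faces V E" using S1 S2' by blast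
  ultimately have "sym_diff S1 S2' = S \<or> sym_diff S1 S2' = faces V E - S"
    using bdry_eq_iff[OF _ S] by blast
  \<comment> \<open>Complementing \<open>S2'\<close> keeps its boundary and complements the
    symmetric difference.\<close>
  then obtain S2 where S2: "S2 \<subseteq> faces V E" "bdry S2 = D2" "sym_diff S1 S2 = S"
  proof
    assume "sym_diff S1 S2' = faces V E - S"
    then have "sym_diff S1 (faces V E - S2') = S" using S S1(1) S2'(1) by blast
    then show ?thesis using that[of "faces V E - S2'"] bdry_Diff_faces[OF S2'(1)] S2'(2) by blast
  qed (use that S2' in blast)
  have sub: "S1 \<inter> S2 \<subseteq> faces V E" using S1 by blast
  have "bdry (S1 \<inter> S2) \<subseteq> insert e (bdry S)"
    using bdry_Int_subset[of S1 S2] unfolding S1(2) S2(2) D(3) .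
  \<comment> \<open>Both faces at \<open>e\<close> lie in \<open>S\<close>, that is, in exactly one
    of \<open>S1\<close> and \<open>S2\<close>, so neither lies in the overlap.\<close>
  moreover have "e \<notin> bdry (S1 \<inter> S2)"
  proof -
    obtain H K where "H \<in> faces V E" "K \<in> faces V E" "H \<noteq> K"
      and HK: "\<And>H'. H' \<in> faces V E \<Longrightarrow> e \<in> boundary_edges E H' \<longleftrightarrow> H' = H \<or> H' = K"
      "\<And>S. S \<subseteq> faces V E \<Longrightarrow> e \<in> bdry S \<longleftrightarrow> (H \<in> S \<longleftrightarrow> K \<notin> S)"
      by (rule edge_faces_bdry[OF e(1)]) blast
    have "H \<in> S" "K \<in> S" using HK(1)[of F] HK(2)[OF S] F S e(2) by auto
    then show ?thesis using HK(2)[OF sub] S2(3) by blast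
  qed
  ultimately have "bdry (S1 \<inter> S2) \<subseteq> bdry S" by blast
  then have "S1 \<inter> S2 = {} \<or> S1 \<inter> S2 = faces V E \<or> S1 \<inter> S2 = S \<or> S1 \<inter> S2 = faces V E - S"
    using bdry_subset_cycle[OF S sub cyc] by blast
  moreover have "F \<notin> S1 \<inter> S2" "F \<in> faces V E" using F(1) S S2(3) by blast+
  ultimately consider "S1 \<inter> S2 = {}" | "S1 \<inter> S2 = faces V E - S" using F(1) by blast
  then show ?thesis
  proof cases
    case 1
    then have "S1 \<union> S2 = S" using S2(3) by blast
    then show ?thesis using that[of S1 S2] 1 S1(2) S2(2) D by simp
  next
    case 2
    let ?T1 = "faces V E - S1" and ?T2 = "faces V E - S2"
    have "?T1 \<union> ?T2 = S" "?T1 \<inter> ?T2 = {}" using 2 S2(3) S S1(1) S2(1) by blast+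
    then show ?thesis
      using that[of ?T1 ?T2] bdry_Diff_faces[OF S1(1)] bdry_Diff_faces[OF S2(1)] S1(2) S2(2) D by simp
  qed
qed

text \<open>If the vertex \<open>w\<close> opposite \<open>p\<close> is off the cycle, removing
  \<open>F\<close> replaces \<open>p\<close> by an ear through \<open>w\<close>. Otherwise all three
  vertices of \<open>F\<close> are on the cycle.\<close>

lemma removable_or_vertices_on_cycle:
  assumes S: "S \<subseteq> faces V E" "is_cycle V E (bdry S)"
    and F: "F \<in> S" "p \<in> boundary_edges E F" "p \<in> bdry S"
  shows "is_cycle V E (bdry (S - {F})) \<or> (\<forall>f\<in>boundary_edges E F. f \<inter> V \<subseteq> \<Union>(bdry S))"
proof -
  have FF: "F \<in> faces V E" using S F by blast
  obtain x y where xy: "p \<inter> V = {x, y}" "x \<noteq> y"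
    using plane_graph_edge_ends[OF pg] F(2) boundary_edges_subset by (metis subsetD)
  obtain w q r where t: "boundary_edges E F = {p, q, r}" "q \<inter> V = {x, w}" "r \<inter> V = {y, w}"
    "w \<in> V" "w \<noteq> x" "w \<noteq> y"
    using is_cycle_triangle[OF pg face_cycle(1,2)[OF FF] F(2) xy(1)] by metis
  have qr: "q \<in> E" "r \<in> E" using boundary_edges_subset[of F] t(1) by auto
  show ?thesis
  proof (cases "w \<in> \<Union>(bdry S)")
    case True
    have "x \<in> \<Union>(bdry S)" "y \<in> \<Union>(bdry S)" using F(3) xy(1) by blast+
    then show ?thesis using True t(1-3) xy(1) by auto
  next
    case False
    have "q \<notin> bdry S" "r \<notin> bdry S" using False t(2,3) by blast+
    then have "bdry (S - {F}) = bdry S - {p} \<union> {q, r}"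
      using bdry_remove[OF S(1) F(1)] t(1) F(3) by auto
    then show ?thesis
      using is_cycle_ear[OF pg S(2) F(3) xy(1) qr(1) t(2) qr(2) t(3,4) False] by simp
  qed
qed

lemma boundary_subset_imp_singleton:
  assumes "S \<subseteq> faces V E" "is_cycle V E (bdry S)" "F \<in> S" "boundary_edges E F \<subseteq> bdry S"
  shows "S = {F}"
  using bdry_subset_cycle[OF assms(1) _ assms(2), of "{F}"] bdry_singleton[of F] assms by auto

text \<open>If some chord splits \<open>S\<close>, a chord whose part \<open>S2\<close> avoiding \<open>F0\<close> is smallest has no further
  chords in \<open>S2\<close>, as two chords never cross.\<close>

lemma removable_face_exists:
  assumes S: "S \<subseteq> faces V E" "is_cycle V E (bdry S)" and F0: "F0 \<in> S" "S \<noteq> {F0}"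
  shows "\<exists>F\<in>S - {F0}. is_cycle V E (bdry (S - {F}))"
proof -
  \<comment> \<open>\<open>S1\<close> always denotes the part with \<open>F0\<close>, so any face of
    \<open>S2\<close> may be removed.\<close>
  define split where "split e S1 S2 \<longleftrightarrow> S1 \<union> S2 = S \<and> S1 \<inter> S2 = {} \<and> is_cycle V E (bdry S1) \<and>
    is_cycle V E (bdry S2) \<and> bdry S1 \<inter> bdry S2 = {e} \<and> F0 \<in> S1" for e S1 S2
  have chord: "\<exists>S1 S2. split f S1 S2" if f: "f \<in> E" "f \<notin> bdry S" "f \<inter> V \<subseteq> \<Union>(bdry S)" "F \<in> S" "f \<in> boundary_edges E F" for f F
  proof -
    obtain S1 S2 where "S1 \<union> S2 = S" "S1 \<inter> S2 = {}" "is_cycle V E (bdry S1)" "is_cycle V E (bdry S2)"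
      "bdry S1 \<inter> bdry S2 = {f}"
      using chord_split[OF S f] .
    then have "split f S1 S2 \<or> split f S2 S1" unfolding split_def using F0(1) by auto
    then show ?thesis by blast
  qed
  have third: "F = F0" if "F \<in> S" "boundary_edges E F \<subseteq> bdry S" for F
    using boundary_subset_imp_singleton[OF S that] F0 by auto
  show ?thesis
  proof (cases "\<exists>e S1 S2. split e S1 S2")
    case False
    \<comment> \<open>Supplies a cycle edge whose face in \<open>S\<close> is not \<open>F0\<close>.
      Otherwise comparison with the triangle of \<open>F0\<close> would leave only all faces for
      \<open>S\<close>, whose boundary is empty.\<close>
    have "\<not> bdry S \<subseteq> boundary_edges E F0"
    proof
      assume "bdry S \<subseteq> boundary_edges E F0"
      moreover have F0F: "F0 \<in> faces V E" using F0 S by blast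
      ultimately have "bdry S \<subseteq> bdry {F0}" "is_cycle V E (bdry {F0})"
        using bdry_singleton face_cycle(1) by auto
      then have "S = {} \<or> S = faces V E \<or> S = {F0} \<or> S = faces V E - {F0}"
        using bdry_subset_cycle[of "{F0}" S] F0F S(1) by auto
      then have "S = faces V E" using F0 by blast
      then have "bdry S = {}" unfolding bdry_def by blast
      then show False using is_cycle_nonempty[OF S(2)] by blast
    qed
    then obtain p where p: "p \<in> bdry S" "p \<notin> boundary_edges E F0" by blast
    then obtain F where F: "F \<in> S" "p \<in> boundary_edges E F" unfolding bdry_def by blast
    then have "F \<noteq> F0" using p by blast
    \<comment> \<open>Without chords, a face with all vertices on the cycle has all its edges there
      and is then the whole of \<open>S\<close>.\<close>
    have "\<not> (\<forall>f\<in>boundary_edges E F. f \<inter> V \<subseteq> \<Union>(bdry S))"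
    proof
      assume "\<forall>f\<in>boundary_edges E F. f \<inter> V \<subseteq> \<Union>(bdry S)"
      then have "boundary_edges E F \<subseteq> bdry S"
        using False chord[OF _ _ _ F(1)] boundary_edges_subset by (metis subset_iff)
      then show False using third[OF F(1)] \<open>F \<noteq> F0\<close> by blast
    qed
    then show ?thesis
      using removable_or_vertices_on_cycle[OF S F p(1)] F(1) \<open>F \<noteq> F0\<close> by blast
  next
    case True
    define P where "P t \<longleftrightarrow> (case t of (e, S1, S2) \<Rightarrow> split e S1 S2)" for t
    have "\<exists>t. P t" using True unfolding P_def by auto
    then obtain t where t: "P t" "\<And>u. P u \<Longrightarrow> card (snd (snd t)) \<le> card (snd (snd u))"
      using ex_has_least_nat[of P _ "\<lambda>t. card (snd (snd t))"] by blast
    obtain e S1 S2 where t_eq: "t = (e, S1, S2)" by (cases t) auto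
    have sp: "split e S1 S2" and min: "\<And>f T1 T2. split f T1 T2 \<Longrightarrow> card S2 \<le> card T2"
      using t unfolding t_eq P_def by force+
    have U: "S1 \<union> S2 = S" "S1 \<inter> S2 = {}" and cycs: "is_cycle V E (bdry S1)" "is_cycle V E (bdry S2)"
      and e: "bdry S1 \<inter> bdry S2 = {e}" and F01: "F0 \<in> S1"
      using sp unfolding split_def by auto
    have sub: "S1 \<subseteq> faces V E" "S2 \<subseteq> faces V E" using U S by auto
    have bS: "bdry S = sym_diff (bdry S1) (bdry S2)" using bdry_Un_disjoint[OF sub U(2)] U(1) by simp
    have eE: "e \<in> E" "e \<notin> bdry S" using e bdry_subset bS by blast+
    \<comment> \<open>A single edge has odd degree at its ends; so \<open>bdry S2\<close> has
      another edge \<open>p\<close>, and \<open>p\<close> lies on \<open>bdry S\<close>.\<close>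
    have "bdry S2 \<noteq> {e}"
    proof
      assume eq: "bdry S2 = {e}"
      obtain a b where "e \<inter> V = {a, b}" using plane_graph_edge_ends[OF pg eE(1)] by metis
      then have "a \<in> V" "{f \<in> bdry S2. a \<in> f} = {e}" using eq by auto
      then show False using bdry_even_degree[OF sub(2), of a] by simp
    qed
    then obtain p where p: "p \<in> bdry S2" "p \<noteq> e" using e by blast
    then have pS: "p \<in> bdry S" using bS e by blast
    obtain F where F: "F \<in> S2" "p \<in> boundary_edges E F" using p(1) unfolding bdry_def by blast
    have FS: "F \<in> S" "F \<noteq> F0" "F \<in> faces V E" using F U F01 S by auto
    \<comment> \<open>A further chord \<open>f\<close> of \<open>F\<close> would not cross
      \<open>e\<close>: either \<open>T2\<close> would be a proper part of \<open>S2\<close>,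
      against minimality, or \<open>T1\<close> and \<open>S1\<close> would be disjoint although both
      contain \<open>F0\<close>.\<close>
    have edges: "f \<in> bdry S \<or> f = e" if f: "f \<in> boundary_edges E F" "f \<inter> V \<subseteq> \<Union>(bdry S)" for f
    proof (rule ccontr)
      assume "\<not> ?thesis"
      then have fn: "f \<notin> bdry S" "f \<noteq> e" by auto
      have fE: "f \<in> E" using f(1) boundary_edges_subset by blast
      obtain T1 T2 where T: "split f T1 T2" using chord[OF fE fn(1) f(2) FS(1) f(1)] by blast
      have TU: "T1 \<union> T2 = S" "T1 \<inter> T2 = {}" and fT: "bdry T1 \<inter> bdry T2 = {f}"
        using T unfolding split_def by auto
      have Tsub: "T1 \<subseteq> faces V E" "T2 \<subseteq> faces V E" using TU S by auto
      have bT: "bdry S = sym_diff (bdry T1) (bdry T2)" using bdry_Un_disjoint[OF Tsub TU(2)] TU(1) by simp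
      have fn': "f \<notin> bdry S1" "f \<notin> bdry S2" using fn bS e by blast+
      have en': "e \<notin> bdry T1" "e \<notin> bdry T2" using fn(2) eE(2) bT fT by blast+
      obtain H K where "H \<in> faces V E" "K \<in> faces V E" "H \<noteq> K"
        "\<And>H'. H' \<in> faces V E \<Longrightarrow> e \<in> boundary_edges E H' \<longleftrightarrow> H' = H \<or> H' = K"
        and HK: "\<And>S. S \<subseteq> faces V E \<Longrightarrow> e \<in> bdry S \<longleftrightarrow> (H \<in> S \<longleftrightarrow> K \<notin> S)"
        by (rule edge_faces_bdry[OF eE(1)]) blast
      obtain M N where "M \<in> faces V E" "N \<in> faces V E" "M \<noteq> N"
        and MN: "\<And>H'. H' \<in> faces V E \<Longrightarrow> f \<in> boundary_edges E H' \<longleftrightarrow> H' = M \<or> H' = N"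
        "\<And>S. S \<subseteq> faces V E \<Longrightarrow> f \<in> bdry S \<longleftrightarrow> (M \<in> S \<longleftrightarrow> N \<notin> S)"
        by (rule edge_faces_bdry[OF fE]) blast
      have "M \<in> S2" "N \<in> S2" using MN(1)[OF FS(3)] f(1) F(1) MN(2)[OF sub(2)] fn'(2) by auto
      then have MN1: "M \<notin> S1" "N \<notin> S1" using U(2) by auto
      have e1: "e \<in> bdry S1" "e \<in> bdry S2" using e by auto
      then have HKS: "H \<in> S1 \<and> K \<in> S2 \<or> H \<in> S2 \<and> K \<in> S1"
        using HK[OF sub(1)] HK[OF sub(2)] U(2) by blast
      \<comment> \<open>The boundary of \<open>S1 \<inter> T'\<close> avoids \<open>e\<close>, since
        neither face at \<open>e\<close> is in \<open>T'\<close>, and avoids \<open>f\<close>, since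
        both faces at \<open>f\<close> are in \<open>S2\<close>. It thus lies in the cycle, and the
        face \<open>F\<close> of \<open>S\<close> outside \<open>S1\<close> leaves only the empty
        set.\<close>
      have noncross: "S1 \<inter> T' = {}" if T': "T' \<subseteq> S" "H \<notin> T'" "K \<notin> T'" "bdry T' \<subseteq> insert f (bdry S)" for T'
      proof -
        have T'f: "S1 \<inter> T' \<subseteq> faces V E" "T' \<subseteq> faces V E" using sub T'(1) S by auto
        have "e \<notin> bdry (S1 \<inter> T')" using HK[OF T'f(1)] T'(2,3) by blast
        moreover have "f \<notin> bdry (S1 \<inter> T')" using MN(2)[OF T'f(1)] MN1 by blast
        moreover have "bdry (S1 \<inter> T') \<subseteq> bdry S1 \<union> bdry T'" by (rule bdry_Int_subset)
        moreover have "bdry S1 \<subseteq> insert e (bdry S)" using bS e by blast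
        ultimately have "bdry (S1 \<inter> T') \<subseteq> bdry S" using T'(4) by blast
        then have "S1 \<inter> T' = {} \<or> S1 \<inter> T' = faces V E \<or> S1 \<inter> T' = S \<or> S1 \<inter> T' = faces V E - S"
          using bdry_subset_cycle[OF S(1) T'f(1) S(2)] by blast
        moreover have "F \<notin> S1" using F(1) U(2) by blast
        ultimately show ?thesis using FS(1,3) U(1) by blast
      qed
      have bT12: "bdry T1 \<subseteq> insert f (bdry S)" "bdry T2 \<subseteq> insert f (bdry S)" using bT fT by blast+
      have F0T: "F0 \<in> T1" using T unfolding split_def by auto
      have "H \<in> S" "K \<in> S" using HKS U by auto
      \<comment> \<open>The edge \<open>e\<close> is on neither \<open>bdry T1\<close> nor
        \<open>bdry T2\<close>, so its two faces lie in the same part.\<close>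
      then consider "H \<in> T1" "K \<in> T1" | "H \<in> T2" "K \<in> T2"
        using HK[OF Tsub(1)] HK[OF Tsub(2)] en' TU by blast
      then show False
      proof cases
        case 1
        then have "S1 \<inter> T2 = {}" using noncross[of T2] TU bT12 by blast
        then have "T2 \<subseteq> S2" using TU(1) U(1) by blast
        moreover have "T2 \<noteq> S2" using 1 HKS TU(2) by blast
        moreover have "finite S2" using sub(2) finite_faces by (rule finite_subset)
        ultimately have "card T2 < card S2" by (intro psubset_card_mono) auto
        then show False using min[OF T] by simp
      next
        case 2
        then have "S1 \<inter> T1 = {}" using noncross[of T1] TU bT12 by blast
        then show False using F01 F0T by blast
      qed
    qed
    show ?thesis
    proof (cases "is_cycle V E (bdry (S - {F}))")
      case True
      then show ?thesis using FS by blast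
    next
      case False
      \<comment> \<open>If removing \<open>F\<close> fails, all its edges are on the cycle or equal
        to \<open>e\<close>, hence in \<open>bdry S2\<close>. Then \<open>S2 = {F}\<close>, and its
        removal leaves \<open>S1\<close>, whose boundary is a cycle, a contradiction.\<close>
      then have all: "\<forall>f\<in>boundary_edges E F. f \<in> bdry S \<or> f = e"
        using removable_or_vertices_on_cycle[OF S FS(1) F(2) pS] edges by blast
      have "f \<in> bdry S2" if f: "f \<in> boundary_edges E F" for f
      proof (cases "f = e")
        case True
        then show ?thesis using e by blast
      next
        case False
        then have "f \<in> bdry S" using all f by blast
        then obtain H K where HK: "H \<in> S" "K \<in> faces V E - S" "f \<in> boundary_edges E H" "f \<in> boundary_edges E K"
          and "f \<in> E"
          unfolding bdry_def by blast
        then show ?thesis unfolding bdry_def using F(1) f U(1) by blast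
      qed
      then have "S2 = {F}" using boundary_subset_imp_singleton[OF sub(2) cycs(2) F(1)] by blast
      then have "S - {F} = S1" using U by blast
      then show ?thesis using cycs(1) FS by auto
    qed
  qed
qed

section \<open>Chains of cycles that differ by one face\<close>

text \<open>The parameter \<open>A\<close> records which faces may be added along a chain, which
  makes it possible to keep chains clear of the replaced face.\<close>

definition cycle_step :: "complex set set \<Rightarrow> complex set set \<Rightarrow> complex set set \<Rightarrow> bool" where
  "cycle_step A c d \<longleftrightarrow> is_cycle V E c \<and> is_cycle V E d \<and> (\<exists>F\<in>A. d = sym_diff c (boundary_edges E F))"

lemma cycle_step_mono:
  assumes "A \<subseteq> B" "(cycle_step A)\<^sup>*\<^sup>* c d"
  shows "(cycle_step B)\<^sup>*\<^sup>* c d"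
proof -
  have "cycle_step A \<le> cycle_step B"
    using assms(1) unfolding cycle_step_def le_fun_def le_bool_def by blast
  then show ?thesis using assms(2) rtranclp_mono by blast
qed

text \<open>Adding the same face a second time undoes a step.\<close>

lemma cycle_step_sym: "(cycle_step A)\<^sup>*\<^sup>* c d \<Longrightarrow> (cycle_step A)\<^sup>*\<^sup>* d c"
proof (induction rule: rtranclp_induct)
  case (step d d')
  then have "cycle_step A d' d" by (auto simp: cycle_step_def)
  then show ?case using step by (meson converse_rtranclp_into_rtranclp)
qed simp

lemma cycle_steps_to_face:
  assumes "S \<subseteq> faces V E" "is_cycle V E (bdry S)" "F0 \<in> S"
  shows "(cycle_step (S - {F0}))\<^sup>*\<^sup>* (bdry S) (boundary_edges E F0)"
proof -
  have "finite S" using assms(1) finite_faces by (rule finite_subset)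
  then show ?thesis using assms
  proof (induction S rule: finite_psubset_induct)
    case (psubset S)
    show ?case
    proof (cases "S = {F0}")
      case True
      then show ?thesis using bdry_singleton psubset.prems by auto
    next
      case False
      then obtain F where F: "F \<in> S" "F \<noteq> F0" "is_cycle V E (bdry (S - {F}))"
        using removable_face_exists psubset.prems by blast
      have "cycle_step (S - {F0}) (bdry S) (bdry (S - {F}))"
        unfolding cycle_step_def using psubset.prems F bdry_remove[OF psubset.prems(1) F(1)] by blast
      moreover have "(cycle_step (S - {F} - {F0}))\<^sup>*\<^sup>* (bdry (S - {F})) (boundary_edges E F0)"
        using psubset.IH[of "S - {F}"] psubset.prems F by blast
      then have "(cycle_step (S - {F0}))\<^sup>*\<^sup>* (bdry (S - {F})) (boundary_edges E F0)"
        by (rule cycle_step_mono[rotated]) blast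
      ultimately show ?thesis by (rule converse_rtranclp_into_rtranclp)
    qed
  qed
qed

text \<open>The start \<open>c\<close> is the first entry and each step appends the triangle of its
  face, so longer prefixes evaluate to the later cycles of the chain. A chain without steps gives
  \<open>[c]\<close>, whose index range is empty.\<close>

lemma cycle_steps_imp_list:
  assumes "(cycle_step A)\<^sup>*\<^sup>* c d" "boundary_edges E ` A \<subseteq> C" "c \<in> C" "is_cycle V E c"
  shows "\<exists>as. as \<noteq> [] \<and> set as \<subseteq> C \<and> d = foldl sym_diff {} as \<and>
    (\<forall>i\<in>{2..length as}. is_cycle V E (foldl sym_diff {} (take i as)))"
  using assms(1)
proof (induction rule: rtranclp_induct)
  case base
  show ?case using assms by (intro exI[of _ "[c]"]) auto
next
  case (step d d')
  then obtain as where as: "as \<noteq> []" "set as \<subseteq> C" "d = foldl sym_diff {} as"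
    "\<forall>i\<in>{2..length as}. is_cycle V E (foldl sym_diff {} (take i as))" by blast
  obtain F where F: "F \<in> A" "d' = sym_diff d (boundary_edges E F)" and cyc: "is_cycle V E d'"
    using step(2) unfolding cycle_step_def by blast
  let ?as = "as @ [boundary_edges E F]"
  have d': "d' = foldl sym_diff {} ?as" using F as(3) by simp
  have "is_cycle V E (foldl sym_diff {} (take i ?as))" if "i \<in> {2..length ?as}" for i
  proof (cases "i \<le> length as")
    case True
    then show ?thesis using that as(4) by simp
  next
    case False
    then have "take i ?as = ?as" using that by simp
    then show ?thesis using cyc d' by simp
  qed
  moreover have "set ?as \<subseteq> C" using as(2) F(1) assms(2) by auto
  ultimately show ?case using d' by (intro exI[of _ ?as]) auto
qed

text \<open>The vertex \<open>w\<close> of \<open>B\<close> opposite \<open>p\<close> is not on the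
  triangle of \<open>A\<close>, since otherwise the triangles would share a second edge. Adding
  \<open>B\<close> thus replaces \<open>p\<close> by an ear.\<close>

lemma adjacent_faces_sym_diff_cycle:
  assumes A: "A \<in> faces V E" and B: "B \<in> faces V E"
    and one: "boundary_edges E A \<inter> boundary_edges E B = {p}"
  shows "is_cycle V E (sym_diff (boundary_edges E A) (boundary_edges E B))"
proof -
  have p: "p \<in> boundary_edges E A" "p \<in> boundary_edges E B" using one by auto
  obtain x y where xy: "p \<inter> V = {x, y}" "x \<noteq> y"
    using plane_graph_edge_ends[OF pg] p(1) boundary_edges_subset by (metis subsetD)
  obtain w q r where t: "boundary_edges E B = {p, q, r}" "q \<inter> V = {x, w}" "r \<inter> V = {y, w}"
    "w \<in> V" "w \<noteq> x" "w \<noteq> y"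
    using is_cycle_triangle[OF pg face_cycle(1,2)[OF B] p(2) xy(1)] by metis
  obtain w' q' r' where t': "boundary_edges E A = {p, q', r'}" "q' \<inter> V = {x, w'}" "r' \<inter> V = {y, w'}"
    using is_cycle_triangle[OF pg face_cycle(1,2)[OF A] p(1) xy(1)] by metis
  have qr: "q \<in> E" "r \<in> E" "q' \<in> E" using boundary_edges_subset[of B] boundary_edges_subset[of A] t(1) t'(1) by auto
  have ne: "q \<noteq> p" "r \<noteq> p" using t(2,3,5,6) xy by (metis doubleton_eq_iff)+
  have "w \<notin> \<Union>(boundary_edges E A)"
  proof
    assume "w \<in> \<Union>(boundary_edges E A)"
    then have "w \<in> (p \<inter> V) \<union> (q' \<inter> V) \<union> (r' \<inter> V)" unfolding t'(1) using t(4) by auto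
    then have "w = w'" unfolding xy(1) t'(2,3) using t(5,6) by auto
    then have "q = q'" using inj_onD[OF plane_graph_inj_on_ends[OF pg] _ qr(1,3)] t(2) t'(2) by simp
    then show False using one t(1) t'(1) ne by auto
  qed
  then have "is_cycle V E (boundary_edges E A - {p} \<union> {q, r})"
    using is_cycle_ear[OF pg face_cycle(1)[OF A] p(1) xy(1) qr(1) t(2) qr(2) t(3,4)] by blast
  moreover have "sym_diff (boundary_edges E A) (boundary_edges E B) = boundary_edges E A - {p} \<union> {q, r}"
  proof -
    have "q \<notin> boundary_edges E A" "r \<notin> boundary_edges E A" using one t(1) ne by auto
    then show ?thesis using t(1) p(1) by auto
  qed
  ultimately show ?thesis by simp
qed

end

section \<open>Chains to a given cycle that avoid the replaced face\<close>

theorem theorem4: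
  fixes V :: "complex set" and E :: "complex set set" and \<alpha> \<beta> :: "complex set set"
  assumes "triangulated_plane_graph V E"
    and "\<alpha> \<in> internal_face_cycles V E"
    and "\<beta> \<in> internal_face_cycles V E"
    and "card (\<alpha> \<inter> \<beta>) = 1"
  shows "cyclically_spans V E (insert (sym_diff \<alpha> \<beta>) (internal_face_cycles V E - {\<alpha>}))"
proof -
  interpret triangulation V E using assms(1) by unfold_locales
  let ?bd = "boundary_edges E" and ?\<Phi> = "faces V E"
  let ?C = "insert (sym_diff \<alpha> \<beta>) (internal_face_cycles V E - {\<alpha>})"
  obtain A B where A: "A \<in> ?\<Phi>" "bounded A" "\<alpha> = ?bd A" and B: "B \<in> ?\<Phi>" "bounded B" "\<beta> = ?bd B"
    using assms(2,3) unfolding internal_face_cycles_def internal_faces_def by auto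
  have "A \<noteq> B" using assms(4) face_cycle(2)[OF A(1)] A(3) B(3) by auto
  obtain out where out: "out \<in> ?\<Phi>" "\<not> bounded out" using unbounded_face_exists by blast
  have out_ne: "out \<noteq> A" "out \<noteq> B" using A B out by auto
  have bounded: "bounded F" if "F \<in> ?\<Phi>" "F \<noteq> out" for F
    using unbounded_face_unique[OF that(1) out(1) _ out(2)] that(2) by blast
  \<comment> \<open>A different face with the same edges as \<open>A\<close> would be the whole
    complement of \<open>{A}\<close>; but that complement also contains \<open>out\<close>.\<close>
  have faces_C: "?bd F \<in> ?C" if F: "F \<in> ?\<Phi> - {A, out}" for F
  proof -
    have "?bd F \<noteq> ?bd A"
    proof
      assume "?bd F = ?bd A"
      then have "bdry {F} = bdry {A}" using bdry_singleton F A(1) by auto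
      then have "{F} = {A} \<or> {F} = ?\<Phi> - {A}" using bdry_eq_iff[of "{F}" "{A}"] F A(1) by blast
      then show False using F out(1) out_ne by blast
    qed
    moreover have "F \<in> internal_faces V E" using bounded F unfolding internal_faces_def by blast
    ultimately show ?thesis unfolding internal_face_cycles_def A(3) by blast
  qed
  obtain p where p: "\<alpha> \<inter> \<beta> = {p}" using assms(4) by (auto simp: card_1_singleton_iff)
  have cyc_ab: "is_cycle V E (sym_diff \<alpha> \<beta>)"
    using adjacent_faces_sym_diff_cycle[OF A(1) B(1)] p unfolding A(3) B(3) by blast
  have "is_cycle V E c" if "c \<in> ?C" for c
    using that cyc_ab face_cycle(1) unfolding internal_face_cycles_def internal_faces_def by auto
  moreover have "\<exists>as. as \<noteq> [] \<and> set as \<subseteq> ?C \<and> \<sigma> = foldl sym_diff {} as \<and>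
      (\<forall>i\<in>{2..length as}. is_cycle V E (foldl sym_diff {} (take i as)))" if \<sigma>: "is_cycle V E \<sigma>" for \<sigma>
  proof -
    obtain S' where S': "S' \<subseteq> ?\<Phi>" "bdry S' = \<sigma>" using cycle_eq_bdry[OF \<sigma>] .
    \<comment> \<open>Complementing keeps the boundary, so the outer face may be assumed to lie
      outside \<open>S\<close>.\<close>
    obtain S where S: "S \<subseteq> ?\<Phi>" "bdry S = \<sigma>" "out \<notin> S"
    proof (cases "out \<in> S'")
      case True
      then show ?thesis using that[of "?\<Phi> - S'"] S' bdry_Diff_faces[OF S'(1)] by blast
    qed (use that S' in blast)
    have steps_from: "\<exists>c. c \<in> ?C \<and> is_cycle V E c \<and> (cycle_step (?\<Phi> - {A, out}))\<^sup>*\<^sup>* c \<sigma>"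
    proof (cases "A \<in> S")
      case True
      \<comment> \<open>The complement of \<open>T\<close> has the same boundary and shrinks to the
        outer face. As \<open>A\<close> is in \<open>T\<close>, it is never among the faces
        removed.\<close>
      have to_out: "(cycle_step (?\<Phi> - {A, out}))\<^sup>*\<^sup>* (bdry T) (?bd out)"
        if T: "T \<subseteq> ?\<Phi>" "A \<in> T" "out \<notin> T" "is_cycle V E (bdry T)" for T
      proof -
        have "(cycle_step (?\<Phi> - T - {out}))\<^sup>*\<^sup>* (bdry (?\<Phi> - T)) (?bd out)"
          using T out(1) bdry_Diff_faces[OF T(1)] by (intro cycle_steps_to_face) auto
        then have "(cycle_step (?\<Phi> - T - {out}))\<^sup>*\<^sup>* (bdry T) (?bd out)"
          unfolding bdry_Diff_faces[OF T(1)] .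
        then show ?thesis by (rule cycle_step_mono[rotated]) (use T in blast)
      qed
      have "bdry {A, B} = sym_diff \<alpha> \<beta>"
        using bdry_Un_disjoint[of "{A}" "{B}"] \<open>A \<noteq> B\<close> A B by (simp add: bdry_singleton insert_commute)
      then have "(cycle_step (?\<Phi> - {A, out}))\<^sup>*\<^sup>* (sym_diff \<alpha> \<beta>) (?bd out)"
        using to_out[of "{A, B}"] A(1) B(1) out_ne cyc_ab by auto
      \<comment> \<open>The outer triangle occurs only as an intermediate cycle and need not belong
        to \<open>?C\<close>.\<close>
      moreover have "(cycle_step (?\<Phi> - {A, out}))\<^sup>*\<^sup>* (?bd out) \<sigma>"
        using cycle_step_sym[OF to_out[OF S(1) True S(3)]] S(2) \<sigma> by simp
      ultimately show ?thesis using cyc_ab by (meson insertI1 rtranclp_trans)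
    next
      case False
      \<comment> \<open>Here \<open>S\<close> contains neither \<open>A\<close> nor the outer face,
        so the triangle of any face \<open>F\<close> of \<open>S\<close> is in \<open>?C\<close>,
        and so are the triangles of all faces added on the way back to
        \<open>\<sigma>\<close>.\<close>
      have "S \<noteq> {}" using S(2) bdry_empty is_cycle_nonempty[OF \<sigma>] by blast
      then obtain F where F: "F \<in> S" by blast
      have "(cycle_step (S - {F}))\<^sup>*\<^sup>* (?bd F) \<sigma>"
        using cycle_step_sym[OF cycle_steps_to_face[OF S(1) _ F]] S(2) \<sigma> by simp
      then have "(cycle_step (?\<Phi> - {A, out}))\<^sup>*\<^sup>* (?bd F) \<sigma>"
        by (rule cycle_step_mono[rotated]) (use S False in blast)
      moreover have F': "F \<in> ?\<Phi> - {A, out}" using F S False by blast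
      ultimately show ?thesis using faces_C[OF F'] face_cycle(1)[of F] F' by blast
    qed
    then obtain c where c: "c \<in> ?C" "is_cycle V E c" "(cycle_step (?\<Phi> - {A, out}))\<^sup>*\<^sup>* c \<sigma>" by blast
    have "?bd ` (?\<Phi> - {A, out}) \<subseteq> ?C" using faces_C by (rule image_subsetI)
    then show ?thesis using cycle_steps_imp_list[OF c(3) _ c(1,2)] by blast
  qed
  ultimately show ?thesis unfolding cyclically_spans_def by blast
qed

end
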